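(* Let $(\Omega,\mathcal{A},\mu)$ be a positive, $\sigma$-finite, complete measure space with $\Omega\subset\mathbb{R}^n$, let $d\in\mathbb{N}$, let $1\leq p_0,p_1,q_0,q_1<\infty$, and let $\rho_0,\rho_1$ be norm functions on $\Omega$. Let $X$ be the set of all locally integrably bounded functions $F:\Omega\to\mathcal{K}_{bcs}(\mathbb{R}^d)$, and let $T:X\to X$ be a linear, monotone operator. Suppose that $$\lVert T(F)\rVert_{L^{q_0}_{\mathcal{K}}(\Omega,\rho_0)}\leq M_0\lVert F\rVert_{L^{p_0}_{\mathcal{K}}(\Omega,\rho_0)},\qquad \lVert T(F)\rVert_{L^{q_1}_{\mathcal{K}}(\Omega,\rho_1)}\leq M_1\lVert F\rVert_{L^{p_1}_{\mathcal{K}}(\Omega,\rho_1)}$$ for all $F\in X$, with constants $M_0,M_1$. Suppose moreover that, for all measurable sets $A\subset\Omega$ and all $S\in\mathcal{K}_{bcs}(\mathbb{R}^d)$ with $\chi_AS\in X$ for which $x\mapsto\rho_0(x,\chi_A(x)S)$ and $x\mapsto\rho_1(x,\chi_A(x)S)$ are bounded, the functions $x\mapsto\rho_0(x,T(\chi_AS)(x))$ and $x\mapsto\rho_1(x,T(\chi_AS)(x))$ are bounded. For $0<\theta<1$ put $$\rho=\rho_\theta^{\ast\ast},\qquad \frac1p=\frac{1-\theta}{p_0}+\frac{\theta}{p_1},\qquad \frac1q=\frac{1-\theta}{q_0}+\frac{\theta}{q_1}.$$ Then for any $0<\theta<1$ there is a constant $M_\theta$, independent of $F$, such that for every simple function $F\in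 L^p_{\mathcal{K}}(\Omega,\rho)$ (in $X$), $$\lVert T(F)\rVert_{L^{q}_{\mathcal{K}}(\Omega,\rho)}\leq M_\theta\lVert F\rVert_{L^{p}_{\mathcal{K}}(\Omega,\rho)}.$$ Consequently (by density), for all such $\rho,p,q$, $T$ is bounded from $L^p_{\mathcal{K}}(\Omega,\rho)$ to $L^q_{\mathcal{K}}(\Omega,\rho)$, i.e. there is a constant $C$ with $\lVert T(F)\rVert_{L^{q}_{\mathcal{K}}(\Omega,\rho)}\leq C\lVert F\rVert_{L^{p}_{\mathcal{K}}(\Omega,\rho)}$ for all $F\in L^p_{\mathcal{K}}(\Omega,\rho)$ in the domain $X$ of $T$.
   Context: $\mathcal{K}_{bcs}(\mathbb{R}^d)$ is the collection of all nonempty, closed, bounded, convex, symmetric ($-E=E$) subsets of $\mathbb{R}^d$. For sets, $E+F=\{x+y:x\in E,y\in F\}$, $\lambda E=\{\lambda x:x\in E\}$; operations on set-valued functions are pointwise, and $\chi_AS$ is the function equal to $S$ on $A$ and $\{0\}$ off $A$. A function $F:\Omega\to\mathcal{K}_{bcs}(\mathbb{R}^d)$ is measurable if $\{x\in\Omega:F(x)\cap U\neq\emptyset\}\in\mathcal{A}$ for every open $U\subset\mathbb{R}^d$; it is locally integrably bounded if it is measurable and there is a non-negative $k\in L^1_{loc}(\Omega)$ with $F(x)$ contained in the ball $B(0,k(x))$ for a.e. $x$. A simple function is a measurable $F:\Omega\to\mathcal{K}_{bcs}(\mathbb{R}^d)$ taking finitely many values. $T$ is linear if $T(F+G)(x)=TF(x)+TG(x)$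 and $T(\lambda F)(x)=\lambda TF(x)$ for all $F,G\in X$, $\lambda\in\mathbb{R}$, $x\in\Omega$; it is monotone if $F(x)\subset G(x)$ for all $x$ implies $TF(x)\subset TG(x)$ for all $x$. A norm function on $\Omega$ is a map $\rho:\Omega\times\mathbb{R}^d\to[0,\infty)$ such that $\rho_x(\cdot)=\rho(x,\cdot)$ is a norm on $\mathbb{R}^d$ for all $x\in\Omega$, and $x\mapsto\rho_x(v)$ is measurable for every $v\in\mathbb{R}^d$. For $E\subset\mathbb{R}^d$, $\rho_x(E)=\rho(x,E)=\sup_{v\in E}\rho_x(v)$. For $0<p<\infty$, $\lVert F\rVert_{L^p_{\mathcal{K}}(\Omega,\rho)}=\left(\int_\Omega\rho_x(F(x))^p\,d\mu(x)\right)^{1/p}$ (possibly $\infty$), and $L^p_{\mathcal{K}}(\Omega,\rho)$ is the set of measurable $F:\Omega\to\mathcal{K}_{bcs}(\mathbb{R}^d)$ for which this is finite. For a function $p:\mathbb{R}^d\to[0,\infty)$ define $p^\ast(v)=\sup_{w\in\mathbb{R}^d,\,p(w)\leq1}|\langle v,w\rangle|$, and $p^{\ast\ast}=(p^\ast)^\ast$. For norm functions $\rho_0,\rho_1$ and $0<\theta<1$, $\rho_\theta(x,v)=\rho_0(x,v)^{1-\theta}\rho_1(x,v)^{\theta}$ (which need not be a norm in $v$), and $\rho_\theta^{\ast\ast}(x,\cdot)=(\rho_\theta(x,\cdot))^{\ast\ast}$, which is a norm for each $x$. *)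

theory Defs
  imports "HOL-Analysis.Analysis"
begin

text \<open>
  The underlying set is \<open>\<Omega> = space M\<close> for a measure \<open>M\<close> on the type \<open>real ^ 'n\<close>.  Functions on
  \<open>\<Omega>\<close> are total HOL functions, only whose values on \<open>space M\<close> matter.  Sums of sets are the
  Minkowski sums of \<^theory>\<open>HOL-Library.Set_Algebras\<close>.
\<close>

definition Kbcs :: "'a::real_normed_vector set set" where
  "Kbcs = {E. E \<noteq> {} \<and> closed E \<and> bounded E \<and> convex E \<and> uminus ` E = E}"

definition set_measurable_fun ::
    "'b measure \<Rightarrow> ('b \<Rightarrow> 'a::real_normed_vector set) \<Rightarrow> bool" where
  "set_measurable_fun M F \<longleftrightarrow>
     (\<forall>x\<in>space M. F x \<in> Kbcs) \<and>
     (\<forall>U. open U \<longrightarrow> {x \<in> space M. F x \<inter> U \<noteq> {}} \<in> sets M)"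

text \<open>
  Local integrability means integrability over every compact subset \<open>K\<close> of \<open>\<Omega>\<close>.  As \<open>K\<close> need not
  belong to an arbitrary sigma-algebra, this is expressed by a measurable superset of \<open>K\<close>; for
  \<open>K \<in> sets M\<close> it says exactly \<open>set_integrable M K k\<close>.
\<close>

definition locally_integrable ::
    "('b::topological_space) measure \<Rightarrow> ('b \<Rightarrow> real) \<Rightarrow> bool" where
  "locally_integrable M k \<longleftrightarrow>
     k \<in> borel_measurable M \<and>
     (\<forall>K. compact K \<and> K \<subseteq> space M \<longrightarrow> (\<exists>A\<in>sets M. K \<subseteq> A \<and> set_integrable M A k))"

definition locally_integrably_bounded ::
    "('b::topological_space) measure \<Rightarrow> ('b \<Rightarrow> 'a::real_normed_vector set) \<Rightarrow> bool" where
  "locally_integrably_bounded M F \<longleftrightarrow>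
     set_measurable_fun M F \<and>
     (\<exists>k. locally_integrable M k \<and> (\<forall>x\<in>space M. 0 \<le> k x) \<and> (AE x in M. F x \<subseteq> cball 0 (k x)))"

definition simple_set_fun :: "'b measure \<Rightarrow> ('b \<Rightarrow> 'a::real_normed_vector set) \<Rightarrow> bool" where
  "simple_set_fun M F \<longleftrightarrow> set_measurable_fun M F \<and> finite (F ` space M)"

definition chi :: "'b set \<Rightarrow> 'a::zero set \<Rightarrow> 'b \<Rightarrow> 'a set" where
  "chi A S = (\<lambda>x. if x \<in> A then S else {0})"

definition linear_operator_on ::
    "'b measure \<Rightarrow> ('b \<Rightarrow> 'a::real_vector set) set \<Rightarrow>
     (('b \<Rightarrow> 'a set) \<Rightarrow> ('b \<Rightarrow> 'a set)) \<Rightarrow> bool" where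
  "linear_operator_on M X T \<longleftrightarrow>
     (\<forall>F\<in>X. \<forall>G\<in>X. \<forall>x\<in>space M. T (\<lambda>y. F y + G y) x = T F x + T G x) \<and>
     (\<forall>F\<in>X. \<forall>c::real. \<forall>x\<in>space M. T (\<lambda>y. (*\<^sub>R) c ` F y) x = (*\<^sub>R) c ` T F x)"

text \<open>
  Since the hypothesis on \<open>F\<close> and \<open>G\<close> only concerns points of \<open>space M\<close>, monotonicity also makes
  \<open>T F\<close> on \<open>space M\<close> depend on the restriction of \<open>F\<close> to \<open>space M\<close> only.
\<close>

definition monotone_operator_on ::
    "'b measure \<Rightarrow> ('b \<Rightarrow> 'a set) set \<Rightarrow> (('b \<Rightarrow> 'a set) \<Rightarrow> ('b \<Rightarrow> 'a set)) \<Rightarrow> bool" where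
  "monotone_operator_on M X T \<longleftrightarrow>
     (\<forall>F\<in>X. \<forall>G\<in>X. (\<forall>x\<in>space M. F x \<subseteq> G x) \<longrightarrow> (\<forall>x\<in>space M. T F x \<subseteq> T G x))"

definition is_norm :: "('a::real_vector \<Rightarrow> real) \<Rightarrow> bool" where
  "is_norm N \<longleftrightarrow>
     (\<forall>v. 0 \<le> N v) \<and> (\<forall>v. N v = 0 \<longleftrightarrow> v = 0) \<and>
     (\<forall>c v. N (c *\<^sub>R v) = \<bar>c\<bar> * N v) \<and> (\<forall>v w. N (v + w) \<le> N v + N w)"

definition norm_function :: "'b measure \<Rightarrow> ('b \<Rightarrow> 'a::real_vector \<Rightarrow> real) \<Rightarrow> bool" where
  "norm_function M \<rho> \<longleftrightarrow>
     (\<forall>x\<in>space M. is_norm (\<rho> x)) \<and> (\<forall>v. (\<lambda>x. \<rho> x v) \<in> borel_measurable M)"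

definition set_size :: "('a \<Rightarrow> real) \<Rightarrow> 'a set \<Rightarrow> real" where
  "set_size N E = (SUP v\<in>E. N v)"

definition ennreal_root :: "real \<Rightarrow> ennreal \<Rightarrow> ennreal" where
  "ennreal_root p a = (if a = \<infinity> then \<infinity> else ennreal (enn2real a powr (1 / p)))"

definition LK_norm ::
    "'b measure \<Rightarrow> real \<Rightarrow> ('b \<Rightarrow> 'a \<Rightarrow> real) \<Rightarrow> ('b \<Rightarrow> 'a set) \<Rightarrow> ennreal" where
  "LK_norm M p \<rho> F =
     ennreal_root p (\<integral>\<^sup>+ x. ennreal (set_size (\<rho> x) (F x) powr p) \<partial>M)"

definition LK ::
    "'b measure \<Rightarrow> real \<Rightarrow> ('b \<Rightarrow> 'a::real_normed_vector \<Rightarrow> real) \<Rightarrow> ('b \<Rightarrow> 'a set) set" where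
  "LK M p \<rho> = {F. set_measurable_fun M F \<and> LK_norm M p \<rho> F < \<infinity>}"

text \<open>
  The suprema in \<open>set_size\<close> and \<open>polar_dual\<close> are real-valued.  They are taken over nonempty sets
  that are bounded above whenever \<open>E \<in> Kbcs\<close> and \<open>N\<close> is a norm on a Euclidean space, respectively
  whenever \<open>N\<close> is a norm, a product \<open>N0 v powr (1 - \<theta>) * N1 v powr \<theta>\<close> of norms, or the dual of
  either.
\<close>

definition polar_dual :: "('a::real_inner \<Rightarrow> real) \<Rightarrow> 'a \<Rightarrow> real" where
  "polar_dual N v = (SUP w\<in>{w. N w \<le> 1}. \<bar>v \<bullet> w\<bar>)"

definition interp_fun ::
    "real \<Rightarrow> ('b \<Rightarrow> 'a \<Rightarrow> real) \<Rightarrow> ('b \<Rightarrow> 'a \<Rightarrow> real) \<Rightarrow> 'b \<Rightarrow> 'a \<Rightarrow> real" where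
  "interp_fun \<theta> \<rho>0 \<rho>1 x v = \<rho>0 x v powr (1 - \<theta>) * \<rho>1 x v powr \<theta>"

definition interp_norm ::
    "real \<Rightarrow> ('b \<Rightarrow> 'a::real_inner \<Rightarrow> real) \<Rightarrow> ('b \<Rightarrow> 'a \<Rightarrow> real) \<Rightarrow> 'b \<Rightarrow> 'a \<Rightarrow> real" where
  "interp_norm \<theta> \<rho>0 \<rho>1 x = polar_dual (polar_dual (interp_fun \<theta> \<rho>0 \<rho>1 x))"

end

theory Submission
  imports Defs
begin

text \<open>
  Positivity replaces complex interpolation. Put \<open>r x = \<rho> x (F x)\<close> and let \<open>G x\<close>, \<open>H x\<close> be the balls
  of radius \<open>r x powr (p / p0)\<close> and \<open>r x powr (p / p1)\<close> for \<open>\<rho>0 x\<close> and \<open>\<rho>1 x\<close>. By the bipolar theorem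
  \<open>F x \<subseteq> s powr \<theta> G x + s powr (\<theta> - 1) H x\<close> for all \<open>s > 0\<close>, and monotonicity and linearity carry this
  over to \<open>T F\<close>, \<open>T G\<close>, \<open>T H\<close>. In dimension \<open>d\<close> such a family of decompositions of a vector bounds its
  interpolated norm by a constant depending only on \<open>d\<close>, and Hoelder's inequality concludes.

  In general \<open>G\<close> and \<open>H\<close> do not belong to \<open>X\<close>. One therefore truncates to the sets \<open>{u \<le> m}\<close>, where
  \<open>u\<close> grows so slowly that \<open>u F\<close> still belongs to \<open>X\<close>; since \<open>m\<close> times the part of \<open>F\<close> on \<open>{u > m}\<close> is
  contained in \<open>u F\<close>, the remainder tends to \<open>0\<close> under \<open>T\<close>.
\<close>

section \<open>Norms and polar duals\<close>

text \<open>The two uses of decompositions are not symmetric. Splitting a vector of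
  \<open>F x\<close> is easy: if \<open>interp_fun\<close> is at most the weighted product of two
  radii, then one of the two norms is at most its radius, so the sublevel set lies in a union of two
  balls, and passing to the bidual merely replaces the union by a Minkowski sum. Reading a bound off
  the splittings of a vector \<open>w\<close> of \<open>T F y\<close> is harder: \<open>g\<close>
  and \<open>h\<close> change with \<open>s\<close>, and only one of the two norms of each is known,
  so no single \<open>s\<close> bounds \<open>interp_norm\<close>. A linear functional of
  \<open>w\<close> can be bounded by optimizing \<open>s\<close>; peeling off one dimension at a
  time gives constants with c(0) = 0 and c(n+1) = 2 + 2 c(n), whence the factor 2^(d+1).

  The values of \<open>T\<close> at the truncations converge only through monotonicity and
  homogeneity. A remainder must therefore be dominated by 1/m times one fixed member of
  \<open>X\<close>, which is the purpose of the weight \<open>u\<close>. It has to satisfy two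
  opposing demands: where \<open>u\<close> is bounded, the Euclidean size of \<open>G\<close> and
  \<open>H\<close> must be controlled, while \<open>u\<close> times the bound of \<open>F\<close>
  must stay locally integrable.\<close>

lemma is_normD:
  assumes "is_norm N"
  shows "0 \<le> N v" "N v = 0 \<longleftrightarrow> v = 0" "N (c *\<^sub>R v) = \<bar>c\<bar> * N v" "N (v + w) \<le> N v + N w"
  using assms unfolding is_norm_def by blast+

lemma is_norm_zero: "is_norm N \<Longrightarrow> N 0 = 0"
  using is_normD(2) by blast

lemma is_norm_minus: "is_norm N \<Longrightarrow> N (- v) = N v"
  using is_normD(3)[of N "-1" v] by simp

lemma is_norm_diff: "is_norm N \<Longrightarrow> N (v - w) \<le> N v + N w"
  using is_normD(4)[of N v "- w"] is_norm_minus[of N w] by simp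

lemma is_norm_sum:
  assumes "is_norm N" "finite I"
  shows "N (\<Sum>i\<in>I. f i) \<le> (\<Sum>i\<in>I. N (f i))"
  using assms(2)
proof (induction I rule: finite_induct)
  case empty
  then show ?case by (simp add: is_norm_zero[OF assms(1)])
next
  case (insert i I)
  then show ?case using is_normD(4)[OF assms(1), of "f i" "\<Sum>i\<in>I. f i"] by simp
qed

lemma is_norm_le_norm:
  fixes N :: "'a::euclidean_space \<Rightarrow> real"
  assumes "is_norm N"
  obtains c where "0 < c" "\<And>v. N v \<le> c * norm v"
proof
  define c where "c = (\<Sum>b\<in>Basis. N b) + 1"
  show "0 < c"
    unfolding c_def by (intro add_nonneg_pos sum_nonneg is_normD(1)[OF assms]) simp
  fix v :: 'a
  have "N v = N (\<Sum>b\<in>Basis. (v \<bullet> b) *\<^sub>R b)" by (simp add: euclidean_representation)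
  also have "\<dots> \<le> (\<Sum>b\<in>Basis. N ((v \<bullet> b) *\<^sub>R b))" by (rule is_norm_sum[OF assms]) simp
  also have "\<dots> = (\<Sum>b\<in>Basis. \<bar>v \<bullet> b\<bar> * N b)" by (simp add: is_normD(3)[OF assms])
  also have "\<dots> \<le> (\<Sum>b\<in>Basis. norm v * N b)"
    by (intro sum_mono mult_right_mono is_normD(1)[OF assms]) (auto simp: Basis_le_norm)
  also have "\<dots> = (\<Sum>b\<in>Basis. N b) * norm v" by (simp add: sum_distrib_left mult.commute)
  also have "\<dots> \<le> c * norm v" by (intro mult_right_mono) (auto simp: c_def)
  finally show "N v \<le> c * norm v" .
qed

lemma is_norm_continuous:
  fixes N :: "'a::euclidean_space \<Rightarrow> real"
  assumes "is_norm N"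
  shows "continuous_on UNIV N"
proof -
  obtain c where c: "0 < c" "\<And>v. N v \<le> c * norm v" using is_norm_le_norm[OF assms] by blast
  have "\<bar>N v - N w\<bar> \<le> c * norm (v - w)" for v w
    using is_normD(4)[OF assms, of "v - w" w] is_normD(4)[OF assms, of "w - v" v]
      c(2)[of "v - w"] c(2)[of "w - v"] by (simp add: norm_minus_commute abs_if)
  then have "c-lipschitz_on UNIV N"
    using c(1) by (intro lipschitz_onI) (auto simp: dist_norm)
  then show ?thesis by (rule lipschitz_on_continuous_on)
qed

lemma is_norm_convex:
  assumes "is_norm N"
  shows "convex {v. N v \<le> a}"
  unfolding convex_alt
proof clarsimp
  fix x y and u :: real assume *: "N x \<le> a" "N y \<le> a" "0 \<le> u" "u \<le> 1"
  have "N ((1 - u) *\<^sub>R x + u *\<^sub>R y) \<le> (1 - u) * N x + u * N y"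
    using is_normD(4)[OF assms, of "(1 - u) *\<^sub>R x" "u *\<^sub>R y"] * by (simp add: is_normD(3)[OF assms])
  also have "\<dots> \<le> (1 - u) * a + u * a" using * by (intro add_mono mult_left_mono) auto
  finally show "N ((1 - u) *\<^sub>R x + u *\<^sub>R y) \<le> a" by (simp add: algebra_simps)
qed

text \<open>The interpolated functions \<open>interp_fun \<theta> \<rho>0 \<rho>1 x\<close> satisfy everything but the triangle
  inequality.\<close>

definition quasi_norm :: "('a::euclidean_space \<Rightarrow> real) \<Rightarrow> bool" where
  "quasi_norm N \<longleftrightarrow> (\<forall>v. 0 \<le> N v) \<and> (\<forall>v. N v = 0 \<longleftrightarrow> v = 0) \<and>
     (\<forall>c v. N (c *\<^sub>R v) = \<bar>c\<bar> * N v) \<and> continuous_on UNIV N"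

lemma quasi_normD:
  assumes "quasi_norm N"
  shows "0 \<le> N v" "N v = 0 \<longleftrightarrow> v = 0" "N (c *\<^sub>R v) = \<bar>c\<bar> * N v" "continuous_on UNIV N"
  using assms unfolding quasi_norm_def by blast+

lemma quasi_norm_zero: "quasi_norm N \<Longrightarrow> N 0 = 0"
  using quasi_normD(2) by blast

lemma is_norm_imp_quasi_norm: "is_norm N \<Longrightarrow> quasi_norm N"
  using is_norm_continuous[of N] unfolding quasi_norm_def is_norm_def by blast

text \<open>Homogeneity holds because the exponents sum to 1; continuity at the zero of the norms
  uses that both exponents are positive.\<close>

lemma quasi_norm_interp_fun:
  assumes "quasi_norm (\<rho>0 x)" "quasi_norm (\<rho>1 x)" "0 < \<theta>" "\<theta> < 1"
  shows "quasi_norm (interp_fun \<theta> \<rho>0 \<rho>1 x)"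
  unfolding quasi_norm_def
proof (intro conjI allI)
  show "continuous_on UNIV (interp_fun \<theta> \<rho>0 \<rho>1 x)"
    unfolding interp_fun_def using assms quasi_normD(1)[OF assms(1)] quasi_normD(1)[OF assms(2)]
    by (intro continuous_intros continuous_on_powr' quasi_normD(4)) auto
  show "0 \<le> interp_fun \<theta> \<rho>0 \<rho>1 x v" for v by (simp add: interp_fun_def)
  show "interp_fun \<theta> \<rho>0 \<rho>1 x v = 0 \<longleftrightarrow> v = 0" for v
    by (simp add: interp_fun_def quasi_normD(2)[OF assms(1)] quasi_normD(2)[OF assms(2)])
  fix c v
  have "\<bar>c\<bar> powr (1 - \<theta>) * \<bar>c\<bar> powr \<theta> = \<bar>c\<bar>" by (simp flip: powr_add)
  then show "interp_fun \<theta> \<rho>0 \<rho>1 x (c *\<^sub>R v) = \<bar>c\<bar> * interp_fun \<theta> \<rho>0 \<rho>1 x v"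
    using quasi_normD(1)[OF assms(1), of v] quasi_normD(1)[OF assms(2), of v]
    by (simp add: interp_fun_def quasi_normD(3)[OF assms(1)] quasi_normD(3)[OF assms(2)] powr_mult
        mult.assoc mult.left_commute) (metis mult.assoc mult.commute)
qed

text \<open>\<open>N\<close> attains a positive minimum on the compact unit sphere. This bounds the
  unit ball of \<open>N\<close>, so that the real-valued supremum in \<open>polar_dual\<close> is a
  genuine one.\<close>

lemma quasi_norm_ge_norm:
  assumes "quasi_norm N"
  obtains c where "0 < c" "\<And>v. c * norm v \<le> N v"
proof -
  have "compact (sphere (0::'a) 1)" "sphere (0::'a) 1 \<noteq> {}" by auto
  moreover have "continuous_on (sphere 0 1) N"
    using quasi_normD(4)[OF assms] continuous_on_subset by blast
  ultimately obtain u where u: "u \<in> sphere 0 1" "\<And>v. v \<in> sphere 0 1 \<Longrightarrow> N u \<le> N v"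
    by (meson continuous_attains_inf)
  show thesis
  proof
    show "0 < N u" using u(1) quasi_normD(1,2)[OF assms, of u] by (force simp: less_le)
    fix v
    show "N u * norm v \<le> N v"
    proof (cases "v = 0")
      case False
      have "N v = norm v * N ((1 / norm v) *\<^sub>R v)" using False by (simp add: quasi_normD(3)[OF assms])
      moreover have "N u \<le> N ((1 / norm v) *\<^sub>R v)" using False by (intro u(2)) simp
      ultimately show ?thesis by (metis mult.commute mult_left_mono norm_ge_zero)
    qed (use quasi_normD(1)[OF assms] in simp)
  qed
qed

lemma polar_dual_bdd:
  assumes "quasi_norm N"
  shows "bdd_above ((\<lambda>w. \<bar>v \<bullet> w\<bar>) ` {w. N w \<le> 1})"
proof -
  obtain c where c: "0 < c" "\<And>v. c * norm v \<le> N v" using quasi_norm_ge_norm[OF assms] by blast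
  have "\<bar>v \<bullet> w\<bar> \<le> norm v * (1 / c)" if "N w \<le> 1" for w
  proof -
    have "\<bar>v \<bullet> w\<bar> \<le> norm v * norm w" by (rule Cauchy_Schwarz_ineq2)
    also have "\<dots> \<le> norm v * (1 / c)"
      using c(2)[of w] c(1) that by (intro mult_left_mono) (auto simp: field_simps)
    finally show ?thesis .
  qed
  then show ?thesis by (intro bdd_aboveI[of _ "norm v * (1 / c)"]) auto
qed

lemma polar_dual_nonneg:
  assumes "quasi_norm N"
  shows "0 \<le> polar_dual N v"
proof -
  have "\<bar>v \<bullet> 0\<bar> \<le> polar_dual N v"
    unfolding polar_dual_def using quasi_normD(2)[OF assms, of 0]
    by (intro cSUP_upper polar_dual_bdd[OF assms]) simp
  then show ?thesis by simp
qed

lemma inner_le_polar_dual: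
  assumes "quasi_norm N"
  shows "\<bar>v \<bullet> w\<bar> \<le> polar_dual N v * N w"
proof (cases "w = 0")
  case False
  then have pos: "0 < N w" using quasi_normD(1,2)[OF assms, of w] by (simp add: less_le)
  have "\<bar>v \<bullet> ((1 / N w) *\<^sub>R w)\<bar> \<le> polar_dual N v"
    unfolding polar_dual_def using pos
    by (intro cSUP_upper polar_dual_bdd[OF assms]) (simp add: quasi_normD(3)[OF assms])
  then show ?thesis using pos by (simp add: abs_mult field_simps)
qed (simp add: quasi_norm_zero[OF assms])

text \<open>Homogeneity turns the supremum over the unit ball into an inequality for all
  \<open>w\<close>. The norm axioms, the bidual estimate and measurability are all read off from
  this form.\<close>

lemma polar_dual_le_iff:
  assumes "quasi_norm N" "0 \<le> a"
  shows "polar_dual N v \<le> a \<longleftrightarrow> (\<forall>w. \<bar>v \<bullet> w\<bar> \<le> a * N w)"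
proof
  assume "polar_dual N v \<le> a"
  then show "\<forall>w. \<bar>v \<bullet> w\<bar> \<le> a * N w"
    using inner_le_polar_dual[OF assms(1), of v] quasi_normD(1)[OF assms(1)]
    by (meson mult_right_mono order_trans)
next
  assume *: "\<forall>w. \<bar>v \<bullet> w\<bar> \<le> a * N w"
  show "polar_dual N v \<le> a"
    unfolding polar_dual_def
  proof (rule cSUP_least)
    show "{w. N w \<le> 1} \<noteq> {}" using quasi_normD(2)[OF assms(1), of 0] by (auto intro!: exI[of _ 0])
    fix w assume "w \<in> {w. N w \<le> 1}"
    then show "\<bar>v \<bullet> w\<bar> \<le> a" using *[rule_format, of w] mult_left_mono[of "N w" 1 a] assms(2) by simp
  qed
qed

lemma is_norm_polar_dual:
  assumes "quasi_norm N"
  shows "is_norm (polar_dual N)"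
  unfolding is_norm_def
proof (intro conjI allI)
  note nn = polar_dual_nonneg[OF assms]
  show "0 \<le> polar_dual N v" for v by (rule nn)
  show "polar_dual N v = 0 \<longleftrightarrow> v = 0" for v
  proof
    assume "polar_dual N v = 0"
    then have "v \<bullet> v \<le> 0" using inner_le_polar_dual[OF assms, of v v] by simp
    then show "v = 0" by (meson inner_gt_zero_iff not_le)
  next
    assume "v = 0"
    then have "polar_dual N v \<le> 0" by (subst polar_dual_le_iff[OF assms]) auto
    then show "polar_dual N v = 0" using nn[of v] by linarith
  qed
  show "polar_dual N (v + w) \<le> polar_dual N v + polar_dual N w" for v w
  proof (subst polar_dual_le_iff[OF assms])
    show "\<forall>u. \<bar>(v + w) \<bullet> u\<bar> \<le> (polar_dual N v + polar_dual N w) * N u"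
    proof
      fix u
      have "\<bar>(v + w) \<bullet> u\<bar> \<le> \<bar>v \<bullet> u\<bar> + \<bar>w \<bullet> u\<bar>" by (simp add: inner_add_left)
      then show "\<bar>(v + w) \<bullet> u\<bar> \<le> (polar_dual N v + polar_dual N w) * N u"
        using inner_le_polar_dual[OF assms, of v u] inner_le_polar_dual[OF assms, of w u]
        by (simp add: distrib_right)
    qed
  qed (simp add: nn)
  have le: "polar_dual N (c *\<^sub>R v) \<le> \<bar>c\<bar> * polar_dual N v" for c v
    by (subst polar_dual_le_iff[OF assms])
      (auto simp: nn abs_mult mult.assoc intro!: mult_left_mono inner_le_polar_dual[OF assms])
  show "polar_dual N (c *\<^sub>R v) = \<bar>c\<bar> * polar_dual N v" for c v
  proof (cases "c = 0")
    case True
    then show ?thesis using le[of c v] nn[of "c *\<^sub>R v"] by simp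
  next
    case False
    then have "polar_dual N v \<le> \<bar>1 / c\<bar> * polar_dual N (c *\<^sub>R v)" using le[of "1 / c" "c *\<^sub>R v"] by simp
    then show ?thesis using False le[of c v] by (simp add: field_simps)
  qed
qed

lemma quasi_norm_polar_dual: "quasi_norm N \<Longrightarrow> quasi_norm (polar_dual N)"
  by (rule is_norm_imp_quasi_norm[OF is_norm_polar_dual])

lemma polar_bidual_le:
  assumes "quasi_norm N"
  shows "polar_dual (polar_dual N) v \<le> N v"
  using inner_le_polar_dual[OF assms]
  by (subst polar_dual_le_iff[OF quasi_norm_polar_dual[OF assms]])
    (auto simp: quasi_normD(1)[OF assms] inner_commute mult.commute)

text \<open>The nontrivial half of the bipolar theorem. A point outside \<open>C\<close> is strictly
  separated from \<open>C\<close> by some \<open>a\<close> at a level \<open>b\<close>; since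
  \<open>0 \<in> C\<close>, \<open>b\<close> is negative, and symmetry of \<open>C\<close> bounds
  the dual norm of \<open>a\<close> by \<open>-b\<close>, which its value at \<open>v\<close>
  exceeds in modulus.\<close>

lemma polar_bidual_ball_subset:
  assumes N: "quasi_norm N"
    and C: "closed C" "convex C" "\<And>v. v \<in> C \<Longrightarrow> - v \<in> C" "{v. N v \<le> 1} \<subseteq> C"
    and v: "polar_dual (polar_dual N) v \<le> 1"
  shows "v \<in> C"
proof (rule ccontr)
  assume "v \<notin> C"
  then obtain a b where ab: "a \<bullet> v < b" "\<And>x. x \<in> C \<Longrightarrow> b < a \<bullet> x"
    using separating_hyperplane_closed_point[OF C(2,1)] by blast
  have C0: "0 \<in> C" using C(4) quasi_normD(2)[OF N, of 0] by auto
  then have b: "b < 0" using ab(2)[of 0] by simp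
  have dual: "polar_dual N a \<le> - b"
  proof (subst polar_dual_le_iff[OF N], use b in simp, intro allI)
    fix w
    show "\<bar>a \<bullet> w\<bar> \<le> - b * N w"
    proof (cases "w = 0")
      case False
      then have pos: "0 < N w" using quasi_normD(1,2)[OF N, of w] by (simp add: less_le)
      define w' where "w' = (1 / N w) *\<^sub>R w"
      have "N w' \<le> 1" using pos by (simp add: w'_def quasi_normD(3)[OF N])
      then have "w' \<in> C" "- w' \<in> C" using C by auto
      then have "\<bar>a \<bullet> w'\<bar> \<le> - b" using ab(2)[of w'] ab(2)[of "- w'"] by (simp add: abs_if)
      then show ?thesis using pos by (simp add: w'_def abs_mult field_simps)
    qed (simp add: quasi_norm_zero[OF N])
  qed
  have "\<bar>v \<bullet> a\<bar> \<le> polar_dual (polar_dual N) v * polar_dual N a"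
    by (rule inner_le_polar_dual[OF quasi_norm_polar_dual[OF N]])
  also have "\<dots> \<le> 1 * (- b)"
    using v dual polar_dual_nonneg[OF N] by (intro mult_mono) auto
  finally show False using ab(1) by (simp add: inner_commute)
qed

lemma is_norm_interp_norm:
  fixes \<rho>0 \<rho>1 :: "'b \<Rightarrow> 'a::euclidean_space \<Rightarrow> real"
  assumes "is_norm (\<rho>0 x)" "is_norm (\<rho>1 x)" "0 < \<theta>" "\<theta> < 1"
  shows "is_norm (interp_norm \<theta> \<rho>0 \<rho>1 x)"
    and "interp_norm \<theta> \<rho>0 \<rho>1 x v \<le> \<rho>0 x v powr (1 - \<theta>) * \<rho>1 x v powr \<theta>"
proof -
  have q: "quasi_norm (interp_fun \<theta> \<rho>0 \<rho>1 x)"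
    using assms by (intro quasi_norm_interp_fun is_norm_imp_quasi_norm)
  show "is_norm (interp_norm \<theta> \<rho>0 \<rho>1 x)"
    unfolding interp_norm_def by (rule is_norm_polar_dual[OF quasi_norm_polar_dual[OF q]])
  show "interp_norm \<theta> \<rho>0 \<rho>1 x v \<le> \<rho>0 x v powr (1 - \<theta>) * \<rho>1 x v powr \<theta>"
    using polar_bidual_le[OF q, of v] unfolding interp_norm_def by (simp add: interp_fun_def)
qed

text \<open>The inequality that characterizes a sublevel set is closed in \<open>w\<close>, so it
  suffices to test it on a countable dense set.\<close>

lemma polar_dual_measurable:
  fixes N :: "'b \<Rightarrow> 'a::euclidean_space \<Rightarrow> real"
  assumes N: "\<And>x. x \<in> space M \<Longrightarrow> quasi_norm (N x)" and meas: "\<And>w. (\<lambda>x. N x w) \<in> borel_measurable M"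
  shows "(\<lambda>x. polar_dual (N x) v) \<in> borel_measurable M"
  unfolding borel_measurable_iff_le
proof
  fix a :: real
  obtain D :: "'a set" where D: "countable D" "\<And>X. open X \<Longrightarrow> X \<noteq> {} \<Longrightarrow> \<exists>d\<in>D. d \<in> X"
    by (rule countable_dense_setE) blast
  have dense: "closure D = UNIV"
    using D(2)[of "- closure D"] closure_subset[of D] by blast
  show "{x \<in> space M. polar_dual (N x) v \<le> a} \<in> sets M"
  proof (cases "0 \<le> a")
    case True
    have "polar_dual (N x) v \<le> a \<longleftrightarrow> (\<forall>w\<in>D. \<bar>v \<bullet> w\<bar> \<le> a * N x w)" if x: "x \<in> space M" for x
    proof -
      have "closed {w. 0 \<le> a * N x w - \<bar>v \<bullet> w\<bar>}"
        using quasi_normD(4)[OF N[OF x]] by (intro closed_Collect_le continuous_intros)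
      then have "(\<forall>w\<in>D. 0 \<le> a * N x w - \<bar>v \<bullet> w\<bar>) \<longleftrightarrow> (\<forall>w. 0 \<le> a * N x w - \<bar>v \<bullet> w\<bar>)"
        using closure_minimal[of D "{w. 0 \<le> a * N x w - \<bar>v \<bullet> w\<bar>}"] dense by blast
      then show ?thesis by (simp add: polar_dual_le_iff[OF N[OF x] True])
    qed
    then have "{x \<in> space M. polar_dual (N x) v \<le> a} = {x \<in> space M. \<forall>w\<in>D. \<bar>v \<bullet> w\<bar> \<le> a * N x w}"
      by blast
    also have "\<dots> \<in> sets M"
      unfolding pred_def[symmetric]
    proof (rule measurable_pred_countable(1)[OF D(1)])
      show "Measurable.pred M (\<lambda>x. \<bar>v \<bullet> w\<bar> \<le> a * N x w)" for w
        using meas[of w] by measurable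
    qed
    finally show ?thesis .
  next
    case False
    then have "{x \<in> space M. polar_dual (N x) v \<le> a} = {}"
      by (auto dest: order_trans[OF polar_dual_nonneg[OF N]])
    then show ?thesis by (metis sets.empty_sets)
  qed
qed

lemma norm_function_interp_norm:
  fixes \<rho>0 \<rho>1 :: "'b \<Rightarrow> 'a::euclidean_space \<Rightarrow> real"
  assumes "norm_function M \<rho>0" "norm_function M \<rho>1" "0 < \<theta>" "\<theta> < 1"
  shows "norm_function M (interp_norm \<theta> \<rho>0 \<rho>1)"
proof -
  have q: "quasi_norm (interp_fun \<theta> \<rho>0 \<rho>1 x)" if "x \<in> space M" for x
    using assms that by (intro quasi_norm_interp_fun is_norm_imp_quasi_norm) (auto simp: norm_function_def)
  have "(\<lambda>x. \<rho>0 x w) \<in> borel_measurable M" "(\<lambda>x. \<rho>1 x w) \<in> borel_measurable M" for w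
    using assms by (auto simp: norm_function_def)
  then have "(\<lambda>x. interp_fun \<theta> \<rho>0 \<rho>1 x w) \<in> borel_measurable M" for w
    unfolding interp_fun_def by measurable
  then have "(\<lambda>x. interp_norm \<theta> \<rho>0 \<rho>1 x v) \<in> borel_measurable M" for v
    unfolding interp_norm_def by (intro polar_dual_measurable quasi_norm_polar_dual q)
  then show ?thesis
    using assms is_norm_interp_norm(1)[of \<rho>0 _ \<rho>1] by (auto simp: norm_function_def)
qed

section \<open>Interpolated norms and decompositions\<close>

text \<open>The choice s = B/A makes the two terms equal, each being the product on the right.
  Enlarging \<open>A\<close> and \<open>B\<close> by \<delta> > 0 makes this choice possible when
  one of them vanishes; \<delta> then tends to 0.\<close>

lemma le_interp_of_le_K:
  fixes x A B \<theta> :: real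
  assumes \<theta>: "0 < \<theta>" "\<theta> < 1" and nonneg: "0 \<le> A" "0 \<le> B"
    and le: "\<And>s. 0 < s \<Longrightarrow> x \<le> s powr \<theta> * A + s powr - (1 - \<theta>) * B"
  shows "x \<le> 2 * (A powr (1 - \<theta>) * B powr \<theta>)"
proof -
  have pos: "x \<le> 2 * ((A + \<delta>) powr (1 - \<theta>) * (B + \<delta>) powr \<theta>)" if "0 < \<delta>" for \<delta>
  proof -
    define a b where "a = A + \<delta>" "b = B + \<delta>"
    have ab: "0 < a" "0 < b" "A \<le> a" "B \<le> b" using nonneg that by (auto simp: a_b_def)
    have "x \<le> (b / a) powr \<theta> * A + (b / a) powr - (1 - \<theta>) * B" using ab by (intro le) simp
    also have "\<dots> \<le> (b / a) powr \<theta> * a + (b / a) powr - (1 - \<theta>) * b"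
      using ab by (intro add_mono mult_left_mono) auto
    also have "\<dots> = 2 * (a powr (1 - \<theta>) * b powr \<theta>)"
    proof -
      have "(b / a) powr \<theta> * a = a powr (1 - \<theta>) * b powr \<theta>"
        using ab by (simp add: powr_divide powr_diff)
      moreover have "(b / a) powr - (1 - \<theta>) * b = a powr (1 - \<theta>) * b powr \<theta>"
        using ab by (simp add: powr_divide powr_diff)
      ultimately show ?thesis by simp
    qed
    finally show ?thesis by (simp add: a_b_def)
  qed
  have "((\<lambda>\<delta>. 2 * ((A + \<delta>) powr (1 - \<theta>) * (B + \<delta>) powr \<theta>)) \<longlongrightarrow>
      2 * ((A + 0) powr (1 - \<theta>) * (B + 0) powr \<theta>)) (at_right 0)"
    using \<theta> nonneg
    by (intro tendsto_intros tendsto_powr') (auto simp: eventually_at_right_less intro!: eventually_at_rightI[of _ 1])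
  moreover have "\<forall>\<^sub>F \<delta> in at_right 0. x \<le> 2 * ((A + \<delta>) powr (1 - \<theta>) * (B + \<delta>) powr \<theta>)"
    using pos by (auto intro!: eventually_at_rightI[of _ 1])
  ultimately have "x \<le> 2 * ((A + 0) powr (1 - \<theta>) * (B + 0) powr \<theta>)"
    by (rule tendsto_lowerbound) simp
  then show ?thesis by simp
qed

text \<open>Hahn-Banach in finite dimension: a hyperplane separating \<open>e\<close> from the open
  unit ball, normalized to the value 1 at \<open>e\<close>.\<close>

lemma is_norm_supporting_functional:
  fixes N :: "'a::euclidean_space \<Rightarrow> real"
  assumes N: "is_norm N" and e: "N e = 1"
  obtains u where "u \<bullet> e = 1" "\<And>v. \<bar>u \<bullet> v\<bar> \<le> N v"
proof -
  have "convex {v. N v < 1}"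
    unfolding convex_alt
  proof clarsimp
    fix x y and t :: real assume *: "N x < 1" "N y < 1" "0 \<le> t" "t \<le> 1"
    have "(1 - t) *\<^sub>R x + t *\<^sub>R y \<in> {v. N v \<le> max (N x) (N y)}"
      using is_norm_convex[OF N, of "max (N x) (N y)"] * unfolding convex_alt by fastforce
    then show "N ((1 - t) *\<^sub>R x + t *\<^sub>R y) < 1" using * by auto
  qed
  moreover have "{v. N v < 1} \<inter> {e} = {}" "{v. N v < 1} \<noteq> {}"
    using e is_norm_zero[OF N] by (auto intro!: exI[of _ 0])
  ultimately obtain a b where ab: "a \<noteq> 0" "\<And>v. N v < 1 \<Longrightarrow> a \<bullet> v \<le> b" "b \<le> a \<bullet> e"
    using separating_hyperplane_sets[of "{v. N v < 1}" "{e}"] by auto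
  have ub: "a \<bullet> v \<le> N v * (a \<bullet> e)" for v
  proof (rule field_le_epsilon)
    fix \<epsilon> :: real assume \<epsilon>: "0 < \<epsilon>"
    have "b \<ge> 0" using ab(2)[of 0] is_norm_zero[OF N] by simp
    then have ae: "0 \<le> a \<bullet> e" using ab(3) by simp
    \<comment> \<open>\<open>t\<close> lies slightly above \<open>N v\<close>, which puts
      \<open>v / t\<close> into the open ball where the separation applies. The summand 1 in the
      denominator is there because \<open>a \<bullet> e\<close> is so far only known to be
      nonnegative.\<close>
    define t where "t = N v + \<epsilon> / (a \<bullet> e + 1)"
    have t: "N v < t" "0 < t" using \<epsilon> ae is_normD(1)[OF N, of v] by (auto simp: t_def intro!: add_nonneg_pos divide_pos_pos)
    have "N ((1 / t) *\<^sub>R v) < 1" using t by (simp add: is_normD(3)[OF N])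
    then have "a \<bullet> ((1 / t) *\<^sub>R v) \<le> a \<bullet> e" using ab(2,3) by force
    then have "a \<bullet> v \<le> t * (a \<bullet> e)" using t by (simp add: field_simps)
    also have "\<dots> = N v * (a \<bullet> e) + \<epsilon> * ((a \<bullet> e) / (a \<bullet> e + 1))" by (simp add: t_def algebra_simps)
    also have "\<dots> \<le> N v * (a \<bullet> e) + \<epsilon> * 1"
      using ae \<epsilon> by (intro add_left_mono mult_left_mono) auto
    finally show "a \<bullet> v \<le> N v * (a \<bullet> e) + \<epsilon>" by simp
  qed
  \<comment> \<open>Testing the bound at \<open>v = a\<close> excludes
    \<open>a \<bullet> e = 0\<close>, so the functional can be normalized.\<close>
  have "0 < a \<bullet> a" using ab(1) by simp
  also have "\<dots> \<le> N a * (a \<bullet> e)" by (rule ub)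
  finally have ae: "0 < a \<bullet> e" using is_normD(1)[OF N, of a] by (simp add: zero_less_mult_iff)
  show thesis
  proof
    show "((1 / (a \<bullet> e)) *\<^sub>R a) \<bullet> e = 1" using ae by simp
    show "\<bar>((1 / (a \<bullet> e)) *\<^sub>R a) \<bullet> v\<bar> \<le> N v" for v
      using ub[of v] ub[of "- v"] ae by (simp add: is_norm_minus[OF N] abs_if field_simps)
  qed
qed

text \<open>The induction splits off a vector \<open>e\<close> of \<open>S\<close> maximizing \<open>N0 / N1\<close>. A supporting functional
  \<open>u\<close> of \<open>N0\<close> at \<open>e\<close> is then optimal for both norms on \<open>S\<close>, so that the projection along \<open>e\<close> onto
  the kernel of \<open>u\<close> at most doubles \<open>N0\<close> and \<open>N1\<close>.\<close>

lemma interp_le_of_K_decomposition_subspace: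
  fixes N0 N1 R :: "'a::euclidean_space \<Rightarrow> real"
  assumes N: "is_norm N0" "is_norm N1" "is_norm R" and \<theta>: "0 < \<theta>" "\<theta> < 1"
    and R: "\<And>v. R v \<le> N0 v powr (1 - \<theta>) * N1 v powr \<theta>"
    and S: "subspace S" "dim S \<le> n" "w \<in> S" and nonneg: "0 \<le> A" "0 \<le> B"
    and dec: "\<And>s. 0 < s \<Longrightarrow> \<exists>g\<in>S. \<exists>h\<in>S. w = g + h \<and>
      N0 g \<le> s powr \<theta> * A \<and> N1 h \<le> s powr - (1 - \<theta>) * B"
  shows "R w \<le> (2 ^ Suc n - 2) * (A powr (1 - \<theta>) * B powr \<theta>)"
  using S nonneg dec
\<comment> \<open>\<open>A\<close> and \<open>B\<close> are generalized because the projection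
  doubles them. The summands are kept inside \<open>S\<close> because the extremality of
  \<open>e\<close> compares the two norms on \<open>S\<close> only.\<close>
proof (induction n arbitrary: S w A B)
  case 0
  then have "w = 0" by (simp add: subset_eq)
  then show ?case by (simp add: is_norm_zero[OF N(3)])
next
  case (Suc n)
  show ?case
  proof (cases "S \<subseteq> {0}")
    case True
    then have "w = 0" using Suc.prems by blast
    moreover have "0 \<le> (2 ^ Suc (Suc n) - 2 :: real)" using self_le_power[of "2::real" "Suc (Suc n)"] by simp
    ultimately show ?thesis by (simp only: is_norm_zero[OF N(3)]) simp
  next
    case False
    then obtain v0 where v0: "v0 \<in> S" "v0 \<noteq> 0" by blast
    have pos: "0 < N0 v" "0 < N1 v" if "v \<noteq> 0" for v
      using that is_normD(1,2)[OF N(1), of v] is_normD(1,2)[OF N(2), of v] by (metis order_le_less)+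
    let ?K = "S \<inter> sphere 0 1"
    have cpt: "compact ?K" using closed_subspace[OF Suc.prems(1)] by (simp add: closed_Int_compact)
    have "(1 / norm v0) *\<^sub>R v0 \<in> ?K" using v0 Suc.prems(1) by (simp add: subspace_scale)
    then have ne: "?K \<noteq> {}" by blast
    have N1K: "N1 v \<noteq> 0" if "v \<in> ?K" for v
      using that is_normD(2)[OF N(2), of v] by auto
    have cont: "continuous_on ?K (\<lambda>v. N0 v / N1 v)"
      using N1K by (intro continuous_on_divide continuous_on_subset[OF is_norm_continuous]) (simp_all add: N)
    obtain e0 where e0: "e0 \<in> ?K" "\<forall>v\<in>?K. N0 v / N1 v \<le> N0 e0 / N1 e0"
      using continuous_attains_sup[OF cpt ne cont] by (rule bexE)
    have e00: "e0 \<noteq> 0" using e0(1) by auto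
    define e where "e = (1 / N0 e0) *\<^sub>R e0"
    define b where "b = N1 e"
    have eS: "e \<in> S" using e0(1) Suc.prems(1) by (simp add: e_def subspace_scale)
    have e1: "N0 e = 1" using pos[OF e00] by (simp add: e_def is_normD(3)[OF N(1)])
    have b: "b = N1 e0 / N0 e0" "0 < b"
      using pos[OF e00] by (auto simp: b_def e_def is_normD(3)[OF N(2)])
    \<comment> \<open>On \<open>S\<close> the quotient \<open>N0 / N1\<close> is at most its value
      1/b at \<open>e\<close>, so the functional bounded by \<open>N0\<close> is also bounded by
      \<open>N1 / b\<close>.\<close>
    have N01: "N0 v \<le> N1 v / b" if "v \<in> S" for v
    proof (cases "v = 0")
      case False
      have "(1 / norm v) *\<^sub>R v \<in> ?K" using False that Suc.prems(1) by (simp add: subspace_scale)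
      with e0(2) have "N0 ((1 / norm v) *\<^sub>R v) / N1 ((1 / norm v) *\<^sub>R v) \<le> N0 e0 / N1 e0" by (rule bspec)
      moreover have "N0 e0 / N1 e0 = 1 / b" by (simp add: b(1))
      ultimately have "N0 v / N1 v \<le> 1 / b"
        using False by (simp add: is_normD(3)[OF N(1)] is_normD(3)[OF N(2)])
      then show ?thesis using pos(2)[OF False] by (simp add: pos_divide_le_eq)
    qed (simp add: is_norm_zero[OF N(1)] is_norm_zero[OF N(2)])
    obtain u where u: "u \<bullet> e = 1" "\<And>v. \<bar>u \<bullet> v\<bar> \<le> N0 v"
      using is_norm_supporting_functional[OF N(1) e1] by blast
    have u1: "\<bar>u \<bullet> v\<bar> \<le> N1 v / b" if "v \<in> S" for v using u(2)[of v] N01[OF that] by linarith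
    define P where "P = (\<lambda>v. v - (u \<bullet> v) *\<^sub>R e)"
    let ?I = "A powr (1 - \<theta>) * B powr \<theta>"
    \<comment> \<open>The one-dimensional case: \<open>u\<close> is estimated by \<open>N0\<close>
      on \<open>g\<close> and by \<open>N1 / b\<close> on \<open>h\<close>, after which
      \<open>s\<close> can be optimized with \<open>B / b\<close> in place of \<open>B\<close>. The
      resulting factor b^(-\<theta>) cancels against the bound b^\<theta> for
      \<open>R e\<close>.\<close>
    have "\<bar>u \<bullet> w\<bar> \<le> 2 * (A powr (1 - \<theta>) * (B / b) powr \<theta>)"
    proof (rule le_interp_of_le_K[OF \<theta>])
      fix s :: real assume "0 < s"
      then obtain g h where gh: "h \<in> S" "w = g + h" "N0 g \<le> s powr \<theta> * A"
        "N1 h \<le> s powr - (1 - \<theta>) * B" using Suc.prems(6) by blast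
      have "\<bar>u \<bullet> w\<bar> \<le> \<bar>u \<bullet> g\<bar> + \<bar>u \<bullet> h\<bar>" using gh(2) by (simp add: inner_add_right)
      also have "\<dots> \<le> N0 g + N1 h / b" using u(2)[of g] u1[OF gh(1)] by linarith
      also have "\<dots> \<le> s powr \<theta> * A + s powr - (1 - \<theta>) * B / b"
        using gh b(2) by (intro add_mono divide_right_mono) auto
      finally show "\<bar>u \<bullet> w\<bar> \<le> s powr \<theta> * A + s powr - (1 - \<theta>) * (B / b)" by simp
    qed (use Suc.prems b(2) in auto)
    moreover have "R e \<le> b powr \<theta>" using R[of e] e1 by (simp add: b_def)
    ultimately have "\<bar>u \<bullet> w\<bar> * R e \<le> 2 * (A powr (1 - \<theta>) * (B / b) powr \<theta>) * b powr \<theta>"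
      using is_normD(1)[OF N(3)] by (intro mult_mono) auto
    also have "\<dots> = 2 * ?I" using b(2) Suc.prems(5) by (simp add: powr_divide)
    finally have first: "\<bar>u \<bullet> w\<bar> * R e \<le> 2 * ?I" .
    define S' where "S' = S \<inter> {v. u \<bullet> v = 0}"
    have S': "subspace S'" using Suc.prems(1) by (simp add: S'_def subspace_inter subspace_hyperplane)
    have "e \<notin> S'" using u(1) by (simp add: S'_def)
    then have "S' \<subset> S" using eS by (auto simp: S'_def)
    then have "span S' \<subset> span S" by (simp only: span_eq_iff[THEN iffD2, OF S'] span_eq_iff[THEN iffD2, OF Suc.prems(1)])
    then have "dim S' < dim S" by (rule dim_psubset)
    then have dimS': "dim S' \<le> n" using Suc.prems(2) by simp
    have PS: "P v \<in> S'" if "v \<in> S" for v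
      using that eS Suc.prems(1) u(1)
      by (simp add: P_def S'_def inner_diff_right subspace_diff subspace_scale)
    \<comment> \<open>As \<open>N0 e = 1\<close> and \<open>N1 e = b\<close>, subtracting the
      component along \<open>e\<close> costs at most the original norm again. Thus \<open>A\<close>
      and \<open>B\<close> are doubled, and since the exponents sum to 1 their weighted product is
      doubled too.\<close>
    have "R (P w) \<le> (2 ^ Suc n - 2) * ((2 * A) powr (1 - \<theta>) * (2 * B) powr \<theta>)"
    proof (rule Suc.IH[OF S' dimS' PS[OF Suc.prems(3)]])
      fix s :: real assume "0 < s"
      then obtain g h where gh: "g \<in> S" "h \<in> S" "w = g + h" "N0 g \<le> s powr \<theta> * A"
        "N1 h \<le> s powr - (1 - \<theta>) * B" using Suc.prems(6) by blast
      have "P w = P g + P h" using gh(3) by (simp add: P_def inner_add_right algebra_simps)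
      moreover have "N0 (P g) \<le> N0 g + \<bar>u \<bullet> g\<bar> * N0 e"
        unfolding P_def using is_norm_diff[OF N(1), of g "(u \<bullet> g) *\<^sub>R e"] by (simp add: is_normD(3)[OF N(1)])
      then have "N0 (P g) \<le> s powr \<theta> * (2 * A)" using u(2)[of g] gh(4) e1 by simp
      moreover have "N1 (P h) \<le> N1 h + \<bar>u \<bullet> h\<bar> * b"
        unfolding P_def using is_norm_diff[OF N(2), of h "(u \<bullet> h) *\<^sub>R e"] by (simp add: is_normD(3)[OF N(2)] b_def)
      then have "N1 (P h) \<le> s powr - (1 - \<theta>) * (2 * B)" using u1[OF gh(2)] gh(5) b(2) by (simp add: field_simps)
      ultimately show "\<exists>g\<in>S'. \<exists>h\<in>S'. P w = g + h \<and> N0 g \<le> s powr \<theta> * (2 * A) \<and>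
          N1 h \<le> s powr - (1 - \<theta>) * (2 * B)" using PS gh(1,2) by blast
    qed (use Suc.prems in auto)
    also have "(2 * A) powr (1 - \<theta>) * (2 * B) powr \<theta> = (2 powr (1 - \<theta>) * 2 powr \<theta>) * ?I"
      using Suc.prems(4,5) by (simp add: powr_mult)
    also have "2 powr (1 - \<theta>) * 2 powr \<theta> = (2::real)" by (simp flip: powr_add)
    finally have second: "R (P w) \<le> (2 ^ Suc n - 2) * (2 * ?I)" .
    have "R w = R ((u \<bullet> w) *\<^sub>R e + P w)" by (simp add: P_def)
    also have "\<dots> \<le> \<bar>u \<bullet> w\<bar> * R e + R (P w)" using is_normD(3,4)[OF N(3)] by metis
    also have "\<dots> \<le> 2 * ?I + (2 ^ Suc n - 2) * (2 * ?I)" using first second by linarith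
    also have "\<dots> = (2 ^ Suc (Suc n) - 2) * ?I" by (simp add: algebra_simps)
    finally show ?thesis .
  qed
qed

lemma interp_le_of_K_decomposition:
  fixes N0 N1 R :: "'a::euclidean_space \<Rightarrow> real"
  assumes "is_norm N0" "is_norm N1" "is_norm R" "0 < \<theta>" "\<theta> < 1"
    and "\<And>v. R v \<le> N0 v powr (1 - \<theta>) * N1 v powr \<theta>" "0 \<le> A" "0 \<le> B"
    and dec: "\<And>s. 0 < s \<Longrightarrow> \<exists>g h. w = g + h \<and> N0 g \<le> s powr \<theta> * A \<and> N1 h \<le> s powr - (1 - \<theta>) * B"
  shows "R w \<le> 2 ^ Suc DIM('a) * (A powr (1 - \<theta>) * B powr \<theta>)"
proof -
  have "R w \<le> (2 ^ Suc DIM('a) - 2) * (A powr (1 - \<theta>) * B powr \<theta>)"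
    using assms by (intro interp_le_of_K_decomposition_subspace[where S = UNIV and ?N0.0 = N0 and ?N1.0 = N1]) auto
  also have "\<dots> \<le> 2 ^ Suc DIM('a) * (A powr (1 - \<theta>) * B powr \<theta>)" by (intro mult_right_mono) auto
  finally show ?thesis .
qed

section \<open>Convex bodies and measurability\<close>

lemma Kbcs_zero_mem:
  assumes "S \<in> Kbcs"
  shows "0 \<in> S"
proof -
  obtain v where v: "v \<in> S" using assms by (auto simp: Kbcs_def)
  then have "- v \<in> S" using assms unfolding Kbcs_def by (metis (mono_tags, lifting) imageI mem_Collect_eq)
  moreover have "convex S" using assms by (simp add: Kbcs_def)
  ultimately have "(1 / 2) *\<^sub>R v + (1 / 2) *\<^sub>R (- v) \<in> S"
    using v by (intro convexD) simp_all
  then show ?thesis by simp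
qed

lemma Kbcs_compact:
  fixes S :: "'a::euclidean_space set"
  shows "S \<in> Kbcs \<Longrightarrow> compact S"
  by (simp add: Kbcs_def compact_eq_bounded_closed)

lemma KbcsI:
  fixes S :: "'a::euclidean_space set"
  assumes "compact S" "convex S" "0 \<in> S" "\<And>v. v \<in> S \<Longrightarrow> - v \<in> S"
  shows "S \<in> Kbcs"
proof -
  have "v \<in> uminus ` S" if "v \<in> S" for v using assms(4)[OF that] by (metis image_eqI minus_minus)
  then show ?thesis
    using assms unfolding Kbcs_def compact_eq_bounded_closed by auto
qed

lemma Kbcs_minus: "S \<in> Kbcs \<Longrightarrow> v \<in> S \<Longrightarrow> - v \<in> S"
  unfolding Kbcs_def by (metis (mono_tags, lifting) imageI mem_Collect_eq)

lemma Kbcs_scale: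
  fixes S :: "'a::euclidean_space set"
  assumes "S \<in> Kbcs"
  shows "(*\<^sub>R) c ` S \<in> Kbcs"
proof (rule KbcsI)
  show "compact ((*\<^sub>R) c ` S)" using Kbcs_compact[OF assms] by (rule compact_scaling)
  show "convex ((*\<^sub>R) c ` S)" using assms by (intro convex_scaling) (simp add: Kbcs_def)
  show "0 \<in> (*\<^sub>R) c ` S" using Kbcs_zero_mem[OF assms] by (metis image_eqI scaleR_zero_right)
  fix v assume "v \<in> (*\<^sub>R) c ` S"
  then obtain w where "w \<in> S" "v = c *\<^sub>R w" by blast
  then show "- v \<in> (*\<^sub>R) c ` S" using Kbcs_minus[OF assms, of w] by (metis image_eqI scaleR_minus_right)
qed

text \<open>Convexity and \<open>0 \<in> S\<close> make \<open>S\<close> star-shaped about the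
  origin. This later compares \<open>m F\<close> with \<open>u F\<close> where \<open>u\<close>
  exceeds \<open>m\<close>.\<close>

lemma Kbcs_scale_mono:
  assumes S: "S \<in> Kbcs" and "0 \<le> c" "c \<le> d"
  shows "(*\<^sub>R) c ` S \<subseteq> (*\<^sub>R) d ` S"
proof (cases "d = 0")
  case True
  then have "c = d" using assms(2,3) by linarith
  then show ?thesis by simp
next
  case False
  then have d: "0 < d" using assms by simp
  show ?thesis
  proof clarify
    fix v assume v: "v \<in> S"
    have "(c / d) *\<^sub>R v + (1 - c / d) *\<^sub>R 0 \<in> S"
      using S v Kbcs_zero_mem[OF S] assms d
      by (intro convexD) (auto simp: Kbcs_def)
    then have "(c / d) *\<^sub>R v \<in> S" by simp
    then show "c *\<^sub>R v \<in> (*\<^sub>R) d ` S" using d by (intro image_eqI[of _ _ "(c / d) *\<^sub>R v"]) simp_all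
  qed
qed

lemma Kbcs_plus:
  fixes S T :: "'a::euclidean_space set"
  assumes "S \<in> Kbcs" "T \<in> Kbcs"
  shows "S + T \<in> Kbcs"
proof (rule KbcsI)
  show "compact (S + T)"
    using compact_sums[OF Kbcs_compact[OF assms(1)] Kbcs_compact[OF assms(2)]]
    by (rule back_subst[of compact]) (auto simp: set_plus_def)
  show "convex (S + T)" using assms by (intro convex_set_plus) (simp_all add: Kbcs_def)
  show "0 \<in> S + T" using set_plus_intro[OF Kbcs_zero_mem[OF assms(1)] Kbcs_zero_mem[OF assms(2)]] by simp
  fix v assume "v \<in> S + T"
  then obtain a b where "a \<in> S" "b \<in> T" "v = a + b" by (rule set_plus_elim)
  then show "- v \<in> S + T"
    using set_plus_intro[OF Kbcs_minus[OF assms(1), of a] Kbcs_minus[OF assms(2), of b]] by simp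
qed

lemma Kbcs_norm_ball:
  fixes N :: "'a::euclidean_space \<Rightarrow> real"
  assumes N: "is_norm N" and "0 \<le> a"
  shows "{v. N v \<le> a} \<in> Kbcs"
proof (rule KbcsI)
  obtain c where c: "0 < c" "\<And>v. c * norm v \<le> N v"
    using quasi_norm_ge_norm[OF is_norm_imp_quasi_norm[OF N]] by blast
  have "norm v \<le> a / c" if "N v \<le> a" for v
    using c(2)[of v] c(1) that by (simp add: field_simps)
  then have "bounded {v. N v \<le> a}" by (intro boundedI[of _ "a / c"]) simp
  moreover have "closed {v. N v \<le> a}"
    using is_norm_continuous[OF N] by (intro closed_Collect_le continuous_intros)
  ultimately show "compact {v. N v \<le> a}" by (simp add: compact_eq_bounded_closed)
  show "convex {v. N v \<le> a}" by (rule is_norm_convex[OF N])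
  show "0 \<in> {v. N v \<le> a}" using assms(2) by (simp add: is_norm_zero[OF N])
  show "- v \<in> {v. N v \<le> a}" if "v \<in> {v. N v \<le> a}" for v
    using that by (simp add: is_norm_minus[OF N])
qed

lemma set_size_bdd:
  fixes N :: "'a::euclidean_space \<Rightarrow> real"
  assumes "is_norm N" "S \<in> Kbcs"
  shows "bdd_above (N ` S)"
proof -
  have "compact (N ` S)"
    using Kbcs_compact[OF assms(2)] continuous_on_subset[OF is_norm_continuous[OF assms(1)]]
    by (intro compact_continuous_image) auto
  then show ?thesis by (intro bounded_imp_bdd_above compact_imp_bounded)
qed

lemma le_set_size:
  fixes N :: "'a::euclidean_space \<Rightarrow> real"
  assumes "is_norm N" "S \<in> Kbcs" "v \<in> S"
  shows "N v \<le> set_size N S"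
  unfolding set_size_def using assms by (intro cSUP_upper set_size_bdd)

lemma set_size_least:
  assumes "S \<in> Kbcs" "\<And>v. v \<in> S \<Longrightarrow> N v \<le> a"
  shows "set_size N S \<le> a"
  unfolding set_size_def using assms Kbcs_zero_mem by (intro cSUP_least) auto

lemma set_size_nonneg:
  fixes N :: "'a::euclidean_space \<Rightarrow> real"
  assumes "is_norm N" "S \<in> Kbcs"
  shows "0 \<le> set_size N S"
  using le_set_size[OF assms Kbcs_zero_mem[OF assms(2)]] is_normD(1)[OF assms(1), of 0] by linarith

lemma set_size_mono:
  fixes N :: "'a::euclidean_space \<Rightarrow> real"
  assumes "is_norm N" "S \<in> Kbcs" "T \<in> Kbcs" "S \<subseteq> T"
  shows "set_size N S \<le> set_size N T"
  using assms by (intro set_size_least le_set_size) auto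

lemma set_size_plus_le:
  fixes N :: "'a::euclidean_space \<Rightarrow> real"
  assumes "is_norm N" "S \<in> Kbcs" "T \<in> Kbcs"
  shows "set_size N (S + T) \<le> set_size N S + set_size N T"
proof (rule set_size_least[OF Kbcs_plus[OF assms(2,3)]])
  fix v assume "v \<in> S + T"
  then obtain a b where ab: "a \<in> S" "b \<in> T" "v = a + b" by (rule set_plus_elim)
  show "N v \<le> set_size N S + set_size N T"
    unfolding ab(3)
    using is_normD(4)[OF assms(1), of a b] le_set_size[OF assms(1,2) ab(1)] le_set_size[OF assms(1,3) ab(2)]
    by linarith
qed

lemma scale_set_size_le:
  fixes N :: "'a::euclidean_space \<Rightarrow> real"
  assumes N: "is_norm N" and S: "S \<in> Kbcs" and "0 \<le> c"
  shows "c * set_size N S \<le> set_size N ((*\<^sub>R) c ` S)"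
proof (cases "c = 0")
  case True
  then have "c * set_size N S = 0" by simp
  then show ?thesis using set_size_nonneg[OF N Kbcs_scale[OF S]] by metis
next
  case False
  then have c: "0 < c" using assms by simp
  have "set_size N S \<le> set_size N ((*\<^sub>R) c ` S) / c"
  proof (rule set_size_least[OF S])
    fix v assume "v \<in> S"
    then have "N (c *\<^sub>R v) \<le> set_size N ((*\<^sub>R) c ` S)"
      by (intro le_set_size[OF N Kbcs_scale[OF S]]) auto
    then show "N v \<le> set_size N ((*\<^sub>R) c ` S) / c" using c by (simp add: is_normD(3)[OF N] field_simps)
  qed
  then show ?thesis using c by (simp add: field_simps)
qed

lemma set_measurable_funD:
  assumes "set_measurable_fun M F"
  shows "x \<in> space M \<Longrightarrow> F x \<in> Kbcs" "open U \<Longrightarrow> {x \<in> space M. F x \<inter> U \<noteq> {}} \<in> sets M"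
  using assms unfolding set_measurable_fun_def by blast+

text \<open>By continuity of scalar multiplication, \<open>c x\<close> times \<open>F x\<close>
  meets \<open>U\<close> iff some basic rectangle mapped into \<open>U\<close> contains
  \<open>c x\<close> in its first side and has a second side meeting \<open>F x\<close>. There are
  only countably many such rectangles.\<close>

lemma set_measurable_fun_scale:
  fixes F :: "'b \<Rightarrow> 'a::euclidean_space set"
  assumes F: "set_measurable_fun M F" and c: "c \<in> borel_measurable M"
  shows "set_measurable_fun M (\<lambda>x. (*\<^sub>R) (c x) ` F x)"
  unfolding set_measurable_fun_def
proof (intro conjI ballI allI impI)
  show "(*\<^sub>R) (c x) ` F x \<in> Kbcs" if "x \<in> space M" for x
    using Kbcs_scale set_measurable_funD(1)[OF F that] .
  fix U :: "'a set" assume U: "open U"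
  obtain \<A> :: "real set set" where \<A>: "countable \<A>" "topological_basis \<A>"
    using ex_countable_basis by blast
  obtain \<B> :: "'a set set" where \<B>: "countable \<B>" "topological_basis \<B>"
    using ex_countable_basis by blast
  define \<P> where "\<P> = {(I, B). I \<in> \<A> \<and> B \<in> \<B> \<and> (\<forall>t\<in>I. \<forall>v\<in>B. t *\<^sub>R v \<in> U)}"
  have "countable \<P>"
    by (rule countable_subset[of _ "\<A> \<times> \<B>"]) (use \<A>(1) \<B>(1) in \<open>auto simp: \<P>_def\<close>)
  moreover have "{x \<in> space M. (*\<^sub>R) (c x) ` F x \<inter> U \<noteq> {}} =
      (\<Union>(I, B)\<in>\<P>. (c -` I \<inter> space M) \<inter> {x \<in> space M. F x \<inter> B \<noteq> {}})"
  proof (intro equalityI subsetI)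
    fix x assume "x \<in> {x \<in> space M. (*\<^sub>R) (c x) ` F x \<inter> U \<noteq> {}}"
    then obtain v where v: "x \<in> space M" "v \<in> F x" "c x *\<^sub>R v \<in> U" by blast
    have "open ((\<lambda>p. fst p *\<^sub>R snd p) -` U)"
      by (rule open_vimage[OF U]) (intro continuous_intros)
    moreover have "(c x, v) \<in> (\<lambda>p. fst p *\<^sub>R snd p) -` U" using v by simp
    ultimately obtain I B where IB: "open I" "open B" "(c x, v) \<in> I \<times> B"
      "I \<times> B \<subseteq> (\<lambda>p. fst p *\<^sub>R snd p) -` U"
      by (rule open_prod_elim)
    then have cI: "c x \<in> I" and vB: "v \<in> B" by auto
    obtain I' where I': "I' \<in> \<A>" "c x \<in> I'" "I' \<subseteq> I" using topological_basisE[OF \<A>(2) IB(1) cI] .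
    obtain B' where B': "B' \<in> \<B>" "v \<in> B'" "B' \<subseteq> B" using topological_basisE[OF \<B>(2) IB(2) vB] .
    have "(I', B') \<in> \<P>" using I' B' IB(4) by (fastforce simp: \<P>_def)
    then show "x \<in> (\<Union>(I, B)\<in>\<P>. (c -` I \<inter> space M) \<inter> {x \<in> space M. F x \<inter> B \<noteq> {}})"
      using v I' B' by blast
  qed (fastforce simp: \<P>_def)
  moreover have "(c -` I \<inter> space M) \<inter> {x \<in> space M. F x \<inter> B \<noteq> {}} \<in> sets M" if "(I, B) \<in> \<P>" for I B
    using that c topological_basis_open[OF \<A>(2), of I] topological_basis_open[OF \<B>(2), of B]
    by (intro sets.Int set_measurable_funD(2)[OF F] measurable_sets[OF c]) (auto simp: \<P>_def)
  ultimately show "{x \<in> space M. (*\<^sub>R) (c x) ` F x \<inter> U \<noteq> {}} \<in> sets M"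
    by (auto intro!: sets.countable_UN')
qed

text \<open>The same device as for scaling, with the continuous map now being addition.\<close>

lemma set_measurable_fun_plus:
  fixes F G :: "'b \<Rightarrow> 'a::euclidean_space set"
  assumes F: "set_measurable_fun M F" and G: "set_measurable_fun M G"
  shows "set_measurable_fun M (\<lambda>x. F x + G x)"
  unfolding set_measurable_fun_def
proof (intro conjI ballI allI impI)
  show "F x + G x \<in> Kbcs" if "x \<in> space M" for x
    using Kbcs_plus set_measurable_funD(1)[OF F that] set_measurable_funD(1)[OF G that] .
  fix U :: "'a set" assume U: "open U"
  obtain \<B> :: "'a set set" where \<B>: "countable \<B>" "topological_basis \<B>"
    using ex_countable_basis by blast
  define \<P> where "\<P> = {(A, B). A \<in> \<B> \<and> B \<in> \<B> \<and> (\<forall>v\<in>A. \<forall>w\<in>B. v + w \<in> U)}"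
  have "countable \<P>"
    by (rule countable_subset[of _ "\<B> \<times> \<B>"]) (use \<B>(1) in \<open>auto simp: \<P>_def\<close>)
  moreover have "{x \<in> space M. (F x + G x) \<inter> U \<noteq> {}} =
      (\<Union>(A, B)\<in>\<P>. {x \<in> space M. F x \<inter> A \<noteq> {}} \<inter> {x \<in> space M. G x \<inter> B \<noteq> {}})"
  proof (intro equalityI subsetI)
    fix x assume "x \<in> {x \<in> space M. (F x + G x) \<inter> U \<noteq> {}}"
    then obtain v w where v: "x \<in> space M" "v \<in> F x" "w \<in> G x" "v + w \<in> U"
      by (auto simp: set_plus_def)
    have "open ((\<lambda>p. fst p + snd p) -` U)"
      by (rule open_vimage[OF U]) (intro continuous_intros)
    moreover have "(v, w) \<in> (\<lambda>p. fst p + snd p) -` U" using v by simp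
    ultimately obtain A B where AB: "open A" "open B" "(v, w) \<in> A \<times> B"
      "A \<times> B \<subseteq> (\<lambda>p. fst p + snd p) -` U"
      by (rule open_prod_elim)
    then have vA: "v \<in> A" and wB: "w \<in> B" by auto
    obtain A' where A': "A' \<in> \<B>" "v \<in> A'" "A' \<subseteq> A" using topological_basisE[OF \<B>(2) AB(1) vA] .
    obtain B' where B': "B' \<in> \<B>" "w \<in> B'" "B' \<subseteq> B" using topological_basisE[OF \<B>(2) AB(2) wB] .
    have "(A', B') \<in> \<P>" using A' B' AB(4) by (fastforce simp: \<P>_def)
    then show "x \<in> (\<Union>(A, B)\<in>\<P>. {x \<in> space M. F x \<inter> A \<noteq> {}} \<inter> {x \<in> space M. G x \<inter> B \<noteq> {}})"
      using v A' B' by blast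
  qed (fastforce simp: \<P>_def)
  moreover have "{x \<in> space M. F x \<inter> A \<noteq> {}} \<inter> {x \<in> space M. G x \<inter> B \<noteq> {}} \<in> sets M"
    if "(A, B) \<in> \<P>" for A B
    using that topological_basis_open[OF \<B>(2), of A] topological_basis_open[OF \<B>(2), of B]
    by (intro sets.Int set_measurable_funD(2)[OF F] set_measurable_funD(2)[OF G]) (auto simp: \<P>_def)
  ultimately show "{x \<in> space M. (F x + G x) \<inter> U \<noteq> {}} \<in> sets M"
    by (auto intro!: sets.countable_UN')
qed

text \<open>A nonzero point of the ball can be shrunk slightly inside \<open>U\<close>, which makes
  the norm inequality strict; an open condition is then met by a point of a countable dense
  set.\<close>

lemma set_measurable_fun_norm_ball:
  fixes \<rho> :: "'b \<Rightarrow> 'a::euclidean_space \<Rightarrow> real"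
  assumes \<rho>: "norm_function M \<rho>" and t: "t \<in> borel_measurable M" "\<And>x. x \<in> space M \<Longrightarrow> 0 \<le> t x"
  shows "set_measurable_fun M (\<lambda>x. {v. \<rho> x v \<le> t x})"
  unfolding set_measurable_fun_def
proof (intro conjI ballI allI impI)
  have N: "is_norm (\<rho> x)" if "x \<in> space M" for x using \<rho> that by (simp add: norm_function_def)
  have meas: "(\<lambda>x. \<rho> x v) \<in> borel_measurable M" for v using \<rho> by (simp add: norm_function_def)
  show "{v. \<rho> x v \<le> t x} \<in> Kbcs" if "x \<in> space M" for x using N t that by (intro Kbcs_norm_ball)
  fix U :: "'a set" assume U: "open U"
  obtain D :: "'a set" where D: "countable D" "\<And>X. open X \<Longrightarrow> X \<noteq> {} \<Longrightarrow> \<exists>d\<in>D. d \<in> X"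
    by (rule countable_dense_setE) blast
  show "{x \<in> space M. {v. \<rho> x v \<le> t x} \<inter> U \<noteq> {}} \<in> sets M"
  \<comment> \<open>Where \<open>t x = 0\<close> the ball is the origin alone and no point satisfies
    the strict inequality, so open sets containing the origin are treated apart; they meet every
    ball.\<close>
  proof (cases "0 \<in> U")
    case True
    have "{v. \<rho> x v \<le> t x} \<inter> U \<noteq> {}" if "x \<in> space M" for x
    proof -
      have "0 \<in> {v. \<rho> x v \<le> t x} \<inter> U" using True t(2)[OF that] is_norm_zero[OF N[OF that]] by simp
      then show ?thesis by blast
    qed
    then have "{x \<in> space M. {v. \<rho> x v \<le> t x} \<inter> U \<noteq> {}} = space M" by blast
    then show ?thesis by simp
  next
    case False
    have "{x \<in> space M. {v. \<rho> x v \<le> t x} \<inter> U \<noteq> {}} = (\<Union>q\<in>D \<inter> U. {x \<in> space M. \<rho> x q < t x})"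
    proof (intro equalityI subsetI)
      fix x assume "x \<in> {x \<in> space M. {v. \<rho> x v \<le> t x} \<inter> U \<noteq> {}}"
      then obtain v where x: "x \<in> space M" and v: "\<rho> x v \<le> t x" "v \<in> U" by blast
      have "v \<noteq> 0" using v False by blast
      then have pos: "0 < \<rho> x v" using is_normD(1,2)[OF N[OF x], of v] by linarith
      have "((\<lambda>\<eta>. (1 - \<eta>) *\<^sub>R v) \<longlongrightarrow> (1 - 0) *\<^sub>R v) (at_right (0::real))" by (intro tendsto_intros)
      then have "\<forall>\<^sub>F \<eta> in at_right (0::real). (1 - \<eta>) *\<^sub>R v \<in> U"
        using U v(2) by (auto dest: topological_tendstoD)
      moreover have "\<forall>\<^sub>F \<eta> in at_right (0::real). 0 < \<eta> \<and> \<eta> < 1"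
        by (auto intro!: eventually_at_rightI[of _ 1])
      ultimately have "\<forall>\<^sub>F \<eta> in at_right (0::real). (1 - \<eta>) *\<^sub>R v \<in> U \<and> 0 < \<eta> \<and> \<eta> < 1"
        by eventually_elim simp
      then obtain \<eta> where \<eta>: "(1 - \<eta>) *\<^sub>R v \<in> U" "0 < \<eta>" "\<eta> < 1"
        using eventually_happens trivial_limit_at_right_real by blast
      have "\<rho> x ((1 - \<eta>) *\<^sub>R v) = (1 - \<eta>) * \<rho> x v" using \<eta> by (simp add: is_normD(3)[OF N[OF x]])
      also have "\<dots> < \<rho> x v" using \<eta> pos by simp
      finally have "\<rho> x ((1 - \<eta>) *\<^sub>R v) < t x" using v by simp
      then have "U \<inter> {w. \<rho> x w < t x} \<noteq> {}" using \<eta> by blast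
      moreover have "open (U \<inter> {w. \<rho> x w < t x})"
        using U is_norm_continuous[OF N[OF x]] by (intro open_Int open_Collect_less continuous_intros)
      ultimately obtain q where "q \<in> D" "q \<in> U" "\<rho> x q < t x" using D(2) by blast
      then show "x \<in> (\<Union>q\<in>D \<inter> U. {x \<in> space M. \<rho> x q < t x})" using x by blast
    qed force
    moreover have "{x \<in> space M. \<rho> x q < t x} \<in> sets M" for q using meas[of q] t(1) by measurable
    ultimately show ?thesis using D(1) by (auto intro!: sets.countable_UN')
  qed
qed

text \<open>\<open>F x\<close> may be thin and miss the dense set \<open>D\<close>, so the norm is
  tested on \<open>D\<close> in a basic open set \<open>B\<close> that meets \<open>F x\<close>.
  Continuity extends the lower bound \<open>r\<close> from \<open>D \<inter> B\<close> to
  \<open>B\<close> as a weak inequality; the gap between \<open>a\<close> and the rational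
  \<open>r\<close> restores strictness.\<close>

lemma set_size_measurable:
  fixes \<rho> :: "'b \<Rightarrow> 'a::euclidean_space \<Rightarrow> real"
  assumes \<rho>: "norm_function M \<rho>" and F: "set_measurable_fun M F"
  shows "(\<lambda>x. set_size (\<rho> x) (F x)) \<in> borel_measurable M"
proof -
  have N: "is_norm (\<rho> x)" if "x \<in> space M" for x using \<rho> that by (simp add: norm_function_def)
  have meas: "(\<lambda>x. \<rho> x v) \<in> borel_measurable M" for v using \<rho> by (simp add: norm_function_def)
  obtain D :: "'a set" where D: "countable D" "\<And>X. open X \<Longrightarrow> X \<noteq> {} \<Longrightarrow> \<exists>d\<in>D. d \<in> X"
    by (rule countable_dense_setE) blast
  obtain \<B> :: "'a set set" where \<B>: "countable \<B>" "topological_basis \<B>"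
    using ex_countable_basis by blast
  have "{x \<in> space M. a < set_size (\<rho> x) (F x)} \<in> sets M" for a
  proof -
    have "{x \<in> space M. a < set_size (\<rho> x) (F x)} =
        (\<Union>(B, r)\<in>\<B> \<times> (\<rat> \<inter> {a<..}). {x \<in> space M. F x \<inter> B \<noteq> {}} \<inter> {x \<in> space M. \<forall>q\<in>D \<inter> B. r < \<rho> x q})"
    proof (intro equalityI subsetI)
      fix x assume "x \<in> {x \<in> space M. a < set_size (\<rho> x) (F x)}"
      then have x: "x \<in> space M" and "\<not> set_size (\<rho> x) (F x) \<le> a" by auto
      then obtain v where v: "v \<in> F x" "a < \<rho> x v"
        using set_size_least[OF set_measurable_funD(1)[OF F x], of "\<rho> x" a] by (meson not_le)
      obtain r where r: "r \<in> \<rat>" "a < r" "r < \<rho> x v" using Rats_dense_in_real[OF v(2)] by blast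
      have "open {w. r < \<rho> x w}"
        using is_norm_continuous[OF N[OF x]] by (intro open_Collect_less continuous_intros)
      then obtain B where B: "B \<in> \<B>" "v \<in> B" "B \<subseteq> {w. r < \<rho> x w}"
        using topological_basisE[OF \<B>(2), of "{w. r < \<rho> x w}" v] r by blast
      show "x \<in> (\<Union>(B, r)\<in>\<B> \<times> (\<rat> \<inter> {a<..}). {x \<in> space M. F x \<inter> B \<noteq> {}} \<inter> {x \<in> space M. \<forall>q\<in>D \<inter> B. r < \<rho> x q})"
        using x v r B by (intro UN_I[of "(B, r)"]) auto
    next
      fix x assume "x \<in> (\<Union>(B, r)\<in>\<B> \<times> (\<rat> \<inter> {a<..}). {x \<in> space M. F x \<inter> B \<noteq> {}} \<inter> {x \<in> space M. \<forall>q\<in>D \<inter> B. r < \<rho> x q})"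
      then obtain B r v where x: "x \<in> space M" and B: "B \<in> \<B>" "a < r" "v \<in> F x" "v \<in> B" "\<forall>q\<in>D \<inter> B. r < \<rho> x q"
        by auto
      have "r \<le> \<rho> x v"
      proof (rule ccontr)
        assume "\<not> r \<le> \<rho> x v"
        then have "B \<inter> {w. \<rho> x w < r} \<noteq> {}" using B(4) by auto
        moreover have "open (B \<inter> {w. \<rho> x w < r})"
          using topological_basis_open[OF \<B>(2) B(1)] is_norm_continuous[OF N[OF x]]
          by (intro open_Int open_Collect_less continuous_intros)
        ultimately obtain q where "q \<in> D" "q \<in> B" "\<rho> x q < r" using D(2) by blast
        then show False using B(5) by force
      qed
      then show "x \<in> {x \<in> space M. a < set_size (\<rho> x) (F x)}"
        using x B(2) le_set_size[OF N[OF x] set_measurable_funD(1)[OF F x] B(3)] by simp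
    qed
    also have "\<dots> \<in> sets M"
    proof (rule sets.countable_UN')
      show "countable (\<B> \<times> (\<rat> \<inter> {a<..}))"
        using \<B>(1) countable_rat by (intro countable_SIGMA countable_Int1) auto
    next
      have "{x \<in> space M. F x \<inter> B \<noteq> {}} \<inter> {x \<in> space M. \<forall>q\<in>D \<inter> B. r < \<rho> x q} \<in> sets M"
        if B: "B \<in> \<B>" for B r
      proof -
      have "countable (D \<inter> B)" using D(1) by blast
      then have "Measurable.pred M (\<lambda>x. \<forall>q\<in>D \<inter> B. r < \<rho> x q)"
      proof (rule measurable_pred_countable(1))
        show "Measurable.pred M (\<lambda>x. r < \<rho> x q)" for q using meas[of q] by measurable
      qed
        then show ?thesis
          using set_measurable_funD(2)[OF F topological_basis_open[OF \<B>(2) B]] by (simp add: pred_def sets.Int)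
      qed
      then show "(\<lambda>(B, r). {x \<in> space M. F x \<inter> B \<noteq> {}} \<inter> {x \<in> space M. \<forall>q\<in>D \<inter> B. r < \<rho> x q}) `
          (\<B> \<times> (\<rat> \<inter> {a<..})) \<subseteq> sets M" by auto
    qed
    finally show ?thesis .
  qed
  then show ?thesis unfolding borel_measurable_iff_greater by blast
qed

section \<open>Local integrability\<close>

text \<open>A member of an open cover that contains \<open>y\<close> swallows all but finitely many
  of the \<open>K n\<close>. The lemma glues a sequence of compact sets of growing outer measure
  into a single compact set.\<close>

lemma compact_insert_Union_shrinking:
  fixes y :: "'a::metric_space"
  assumes K: "\<And>n. compact (K n)" "\<And>n. K n \<subseteq> cball y (1 / Suc n)"
  shows "compact (insert y (\<Union>n. K n))"
proof (rule compactI)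
  fix \<C> assume \<C>: "\<forall>T\<in>\<C>. open T" "insert y (\<Union>n. K n) \<subseteq> \<Union>\<C>"
  then obtain U where U: "U \<in> \<C>" "y \<in> U" by blast
  then obtain e where e: "0 < e" "cball y e \<subseteq> U" using \<C>(1) open_contains_cball by blast
  obtain m where m: "1 / Suc m < e" using e(1) nat_approx_posE by blast
  have tail: "K n \<subseteq> U" if "m \<le> n" for n
  proof -
    have "1 / Suc n \<le> (1 / Suc m :: real)" using that by (simp add: frac_le)
    then have "cball y (1 / Suc n) \<subseteq> cball y e" using m by (intro subset_cball) simp
    then show ?thesis using K(2)[of n] e(2) by blast
  qed
  have "compact (\<Union>n\<in>{..<m}. K n)" using K(1) by (intro compact_UN) auto
  moreover have "(\<Union>n\<in>{..<m}. K n) \<subseteq> \<Union>\<C>" using \<C>(2) by blast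
  ultimately obtain \<D> where \<D>: "\<D> \<subseteq> \<C>" "finite \<D>" "(\<Union>n\<in>{..<m}. K n) \<subseteq> \<Union>\<D>"
    using \<C>(1) by (meson compactE)
  have "insert y (\<Union>n. K n) \<subseteq> \<Union>(insert U \<D>)"
    proof
    fix x assume "x \<in> insert y (\<Union>n. K n)"
    then consider "x = y" | n where "x \<in> K n" by blast
    then show "x \<in> \<Union>(insert U \<D>)"
    proof cases
      case 2
      then show ?thesis using tail[of n] \<D>(3) by (cases "m \<le> n") (auto simp: subset_eq not_le)
    qed (use U(2) in simp)
  qed
  then show "\<exists>\<C>'\<subseteq>\<C>. finite \<C>' \<and> insert y (\<Union>n. K n) \<subseteq> \<Union>\<C>'"
    using \<D> U(1) by (intro exI[of _ "insert U \<D>"]) auto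
qed

text \<open>If the compact subsets of \<open>V\<close> have uniformly bounded outer measure, then the union of a
  maximizing sequence absorbs each of them up to a null set.\<close>

lemma compact_subsets_essential_hull:
  fixes V :: "'a::t2_space set"
  assumes V: "V \<subseteq> space N"
    and bound: "\<And>K. compact K \<Longrightarrow> K \<subseteq> V \<Longrightarrow> outer_measure_of N K \<le> s" and s: "s < \<infinity>"
  obtains C where "C \<in> sets N" "emeasure N C < \<infinity>"
    "\<And>K. compact K \<Longrightarrow> K \<subseteq> V \<Longrightarrow> \<exists>D\<in>sets N. K \<subseteq> D \<and> emeasure N (D - C) = 0"
proof -
  let ?\<K> = "{K. compact K \<and> K \<subseteq> V}"
  define \<sigma> where "\<sigma> = (SUP K\<in>?\<K>. outer_measure_of N K)"
  have \<sigma>s: "\<sigma> \<le> s" unfolding \<sigma>_def using bound by (intro SUP_least) auto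
  have ub: "outer_measure_of N K \<le> \<sigma>" if "compact K" "K \<subseteq> V" for K
    unfolding \<sigma>_def using that by (intro SUP_upper) auto
  have "?\<K> \<noteq> {}" by (auto intro!: exI[of _ "{}"])
  then obtain k :: "nat \<Rightarrow> ennreal" where k: "range k \<subseteq> outer_measure_of N ` ?\<K>" "\<sigma> = (SUP n. k n)"
    unfolding \<sigma>_def using ennreal_Sup_countable_SUP[of "outer_measure_of N ` ?\<K>"] by auto
  then have "\<exists>K. compact K \<and> K \<subseteq> V \<and> outer_measure_of N K = k n" for n
    using k(1) by (metis (no_types, lifting) imageE mem_Collect_eq range_subsetD)
  then obtain L where L: "\<And>n. compact (L n)" "\<And>n. L n \<subseteq> V" "\<And>n. outer_measure_of N (L n) = k n"
    by metis
  define K where "K n = (\<Union>i\<le>n. L i)" for n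
  have K: "compact (K n)" "K n \<subseteq> V" "L n \<subseteq> K n" for n
    using L by (auto simp: K_def intro: compact_UN)
  have inc: "incseq K" by (force simp: incseq_def K_def)
  define W where "W = (\<Union>n. K n)"
  have WV: "W \<subseteq> V" using K(2) by (auto simp: W_def)
  have W_ge: "\<sigma> \<le> outer_measure_of N W"
    unfolding k(2) using K(3) by (intro SUP_least) (metis L(3) UN_upper UNIV_I W_def outer_measure_of_mono order_trans)
  \<comment> \<open>\<open>W \<union> P\<close> is an increasing union of compact subsets of
    \<open>V\<close>, so continuity of the outer measure from below keeps it at
    \<open>\<sigma>\<close>, a value that \<open>W\<close> alone already reaches.\<close>
  have WK: "outer_measure_of N (W \<union> P) \<le> \<sigma>" if P: "compact P" "P \<subseteq> V" for P
  proof -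
    have eq: "W \<union> P = (\<Union>n. K n \<union> P)" by (auto simp: W_def)
    have "incseq (\<lambda>n. K n \<union> P)" using inc unfolding incseq_def by blast
    then have "outer_measure_of N (\<Union>n. K n \<union> P) = (SUP n. outer_measure_of N (K n \<union> P))"
      using K(2) P(2) V by (intro SUP_outer_measure_of_incseq[symmetric]) blast+
    also have "\<dots> \<le> \<sigma>" using K P by (intro SUP_least ub) (auto intro: compact_Un)
    finally show ?thesis by (simp add: eq)
  qed
  obtain C where C: "C \<in> sets N" "W \<subseteq> C" "outer_measure_of N W = emeasure N C"
    using outer_measure_of_attain[of W N] WV V by blast
  have C\<sigma>: "emeasure N C \<le> \<sigma>" using WK[of "{}"] C(3) by simp
  show thesis
  proof
    show "C \<in> sets N" by (rule C)
    show "emeasure N C < \<infinity>" using C\<sigma> \<sigma>s s by (meson order_le_less_trans)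
    fix P assume P: "compact P" "P \<subseteq> V"
    obtain D where D: "D \<in> sets N" "W \<union> P \<subseteq> D" "outer_measure_of N (W \<union> P) = emeasure N D"
      using outer_measure_of_attain[of "W \<union> P" N] WV V P by blast
    \<comment> \<open>\<open>D \<inter> C\<close> contains \<open>W\<close> and so has measure at
      least \<open>\<sigma>\<close>, while \<open>D\<close> has measure at most
      \<open>\<sigma>\<close>. As \<open>\<sigma>\<close> is finite, subtraction shows that
      \<open>D - C\<close> is null.\<close>
    have "\<sigma> \<le> emeasure N (D \<inter> C)"
    proof -
      have "\<sigma> \<le> outer_measure_of N W" by (rule W_ge)
      also have "\<dots> \<le> outer_measure_of N (D \<inter> C)" using C D by (intro outer_measure_of_mono) blast
      finally show ?thesis using C D by simp
    qed
    moreover have "emeasure N D \<le> \<sigma>" using WK[OF P] D(3) by simp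
    moreover have "emeasure N D = emeasure N (D - C) + emeasure N (D \<inter> C)"
      using C(1) D(1) by (subst plus_emeasure) (auto simp: Diff_Int_distrib Un_Diff_Int)
    moreover have "emeasure N (D \<inter> C) < \<infinity>"
      using calculation(2) \<sigma>s s by (metis C(1) D(1) Int_lower1 emeasure_mono order_le_less_trans)
    ultimately have "emeasure N (D - C) = 0"
      by (metis add.commute add.right_neutral ennreal_add_left_cancel_le infinity_ennreal_def le_zero_eq order_trans top.not_eq_extremum)
    then show "\<exists>D\<in>sets N. P \<subseteq> D \<and> emeasure N (D - C) = 0" using D by blast
  qed
qed

text \<open>Near each point the outer measures of compact sets are uniformly bounded, which yields a
  local hull of finite measure. Countably many of these neighbourhoods cover the space, and finitely
  many cover a given compact set, so finite unions of local hulls suffice up to null sets.\<close>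

lemma compact_finite_exhaustion:
  fixes N :: "'a::{second_countable_topology,metric_space} measure"
  assumes fin: "\<And>K. compact K \<Longrightarrow> K \<subseteq> space N \<Longrightarrow> outer_measure_of N K < \<infinity>"
  obtains A :: "nat \<Rightarrow> 'a set" where "range A \<subseteq> sets N" "incseq A" "\<And>i. emeasure N (A i) < \<infinity>"
    "\<And>K. compact K \<Longrightarrow> K \<subseteq> space N \<Longrightarrow> \<exists>i. \<exists>B\<in>sets N. K \<subseteq> B \<and> emeasure N (B - A i) = 0"
proof -
  \<comment> \<open>A gliding hump: if no radius and bound worked at \<open>y\<close>, compact sets
    \<open>K n\<close> of outer measure above \<open>n\<close> would shrink to \<open>y\<close>, and
    together with \<open>y\<close> they would form a compact set of infinite outer measure.\<close>
  have "\<exists>e>0. \<exists>s. s < \<infinity> \<and> (\<forall>K. compact K \<longrightarrow> K \<subseteq> cball y e \<inter> space N \<longrightarrow> outer_measure_of N K \<le> s)"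
    if y: "y \<in> space N" for y
  proof (rule ccontr)
    assume neg: "\<not> ?thesis"
    have "\<exists>K. compact K \<and> K \<subseteq> cball y (1 / Suc n) \<inter> space N \<and> \<not> outer_measure_of N K \<le> of_nat n" for n
      using neg by (auto simp: of_nat_less_top)
    then obtain K where K: "\<And>n. compact (K n)" "\<And>n. K n \<subseteq> cball y (1 / Suc n)" "\<And>n. K n \<subseteq> space N"
      "\<And>n. \<not> outer_measure_of N (K n) \<le> of_nat n" by (metis le_inf_iff)
    let ?L = "insert y (\<Union>n. K n)"
    have "outer_measure_of N ?L < \<infinity>"
      using K(3) y by (intro fin compact_insert_Union_shrinking K) auto
    then obtain n where "outer_measure_of N ?L < of_nat n" using ennreal_Ex_less_of_nat by auto
    moreover have "outer_measure_of N (K n) \<le> outer_measure_of N ?L" by (intro outer_measure_of_mono) auto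
    ultimately show False using K(4)[of n] by simp
  qed
  then obtain e s where es: "\<And>y. y \<in> space N \<Longrightarrow> 0 < e y" "\<And>y. y \<in> space N \<Longrightarrow> s y < \<infinity>"
    "\<And>y K. y \<in> space N \<Longrightarrow> compact K \<Longrightarrow> K \<subseteq> cball y (e y) \<inter> space N \<Longrightarrow> outer_measure_of N K \<le> s y"
    by metis
  have "\<exists>C. C \<in> sets N \<and> emeasure N C < \<infinity> \<and> (\<forall>K. compact K \<longrightarrow> K \<subseteq> cball y (e y) \<inter> space N \<longrightarrow>
      (\<exists>D\<in>sets N. K \<subseteq> D \<and> emeasure N (D - C) = 0))" if "y \<in> space N" for y
    using compact_subsets_essential_hull[of "cball y (e y) \<inter> space N" N "s y"] es(2,3)[OF that]
    by (metis inf_le2)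
  then obtain C where C: "\<And>y. y \<in> space N \<Longrightarrow> C y \<in> sets N" "\<And>y. y \<in> space N \<Longrightarrow> emeasure N (C y) < \<infinity>"
    "\<And>y K. y \<in> space N \<Longrightarrow> compact K \<Longrightarrow> K \<subseteq> cball y (e y) \<inter> space N \<Longrightarrow>
      \<exists>D\<in>sets N. K \<subseteq> D \<and> emeasure N (D - C y) = 0"
    by metis
  \<comment> \<open>The local hulls belong to closed balls, whose intersections with compact sets
    are compact; the open balls of the same radii serve for covering.\<close>
  obtain \<F> where \<F>: "\<F> \<subseteq> (\<lambda>y. ball y (e y)) ` space N" "countable \<F>"
    "\<Union>\<F> = (\<Union>y\<in>space N. ball y (e y))"
    using Lindelof[of "(\<lambda>y. ball y (e y)) ` space N"] by auto
  obtain Y where Y: "Y \<subseteq> space N" "countable Y" "\<F> = (\<lambda>y. ball y (e y)) ` Y"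
    using countable_subset_image[of \<F> "\<lambda>y. ball y (e y)" "space N"] \<F>(1,2) by auto
  have cover: "space N \<subseteq> (\<Union>y\<in>Y. ball y (e y))" using \<F>(3) Y(3) es(1) by force
  show thesis
  proof (cases "Y = {}")
    case True
    then have "space N = {}" using cover by simp
    then show thesis using that[of "\<lambda>_. {}"] by force
  next
    case False
    define y where "y = from_nat_into Y"
    have ran: "range y = Y" using False Y(2) by (simp add: y_def)
    then have yN: "y i \<in> space N" for i using Y(1) by blast
    define A where "A n = (\<Union>i\<le>n. C (y i))" for n
    show thesis
    proof
      show "range A \<subseteq> sets N" using C(1)[OF yN] by (auto simp: A_def)
      show "incseq A" by (force simp: incseq_def A_def)
      show "emeasure N (A n) < \<infinity>" for n
      proof -
        have "emeasure N (A n) \<le> (\<Sum>i\<le>n. emeasure N (C (y i)))"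
          unfolding A_def using C(1)[OF yN] by (intro emeasure_subadditive_finite) auto
        also have "\<dots> < \<infinity>" using C(2)[OF yN] by (simp add: less_top)
        finally show ?thesis .
      qed
      fix K assume K: "compact K" "K \<subseteq> space N"
      have "K \<subseteq> (\<Union>i. ball (y i) (e (y i)))" using K(2) cover unfolding ran[symmetric] by blast
      then obtain I where I: "finite I" "K \<subseteq> (\<Union>i\<in>I. ball (y i) (e (y i)))"
        using compactE_image[OF K(1), of UNIV "\<lambda>i. ball (y i) (e (y i))"] by auto
      have "\<exists>D. D \<in> sets N \<and> K \<inter> cball (y i) (e (y i)) \<subseteq> D \<and> emeasure N (D - C (y i)) = 0" for i
      proof -
        have "compact (K \<inter> cball (y i) (e (y i)))" using K(1) by (intro compact_Int_closed) auto
        then show ?thesis using C(3)[OF yN, of "K \<inter> cball (y i) (e (y i))" i] K(2) by blast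
      qed
      then obtain D where D: "\<And>i. D i \<in> sets N" "\<And>i. K \<inter> cball (y i) (e (y i)) \<subseteq> D i"
        "\<And>i. emeasure N (D i - C (y i)) = 0" by metis
      obtain n where n: "I \<subseteq> {..n}" using I(1) unfolding finite_nat_iff_bounded_le by (rule exE)
      show "\<exists>i. \<exists>B\<in>sets N. K \<subseteq> B \<and> emeasure N (B - A i) = 0"
      proof (intro exI[of _ n] bexI[of _ "\<Union>i\<le>n. D i"] conjI)
        show "K \<subseteq> (\<Union>i\<le>n. D i)"
        proof
          fix x assume "x \<in> K"
          then obtain i where "i \<in> I" "x \<in> ball (y i) (e (y i))" using I by blast
          then show "x \<in> (\<Union>i\<le>n. D i)" using n D(2)[of i] \<open>x \<in> K\<close> ball_subset_cball by fastforce
        qed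
        have "(\<Union>i\<in>{..n}. D i - C (y i)) \<in> null_sets N"
          using D C(1)[OF yN] by (intro null_sets.finite_UN) auto
        then have "emeasure N (\<Union>i\<le>n. D i - C (y i)) = 0" by (rule null_setsD1)
        moreover have "emeasure N ((\<Union>i\<le>n. D i) - A n) \<le> emeasure N (\<Union>i\<le>n. D i - C (y i))"
          using D(1) C(1)[OF yN] by (intro emeasure_mono) (auto simp: A_def)
        ultimately show "emeasure N ((\<Union>i\<le>n. D i) - A n) = 0" by simp
      qed (use D(1) in auto)
    qed
  qed
qed

lemma locally_integrable_measurable: "locally_integrable M k \<Longrightarrow> k \<in> borel_measurable M"
  by (simp add: locally_integrable_def)

lemma locally_integrableE:
  assumes "locally_integrable M k" "compact K \<and> K \<subseteq> space M"
  obtains A where "A \<in> sets M" "K \<subseteq> A" "set_integrable M A k"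
  using assms unfolding locally_integrable_def by blast

lemma locally_integrable_bound:
  assumes "locally_integrable M k" "f \<in> borel_measurable M" "\<And>x. x \<in> space M \<Longrightarrow> \<bar>f x\<bar> \<le> \<bar>k x\<bar>"
  shows "locally_integrable M f"
proof -
  have f: "set_integrable M A f" if "A \<in> sets M" "set_integrable M A k" for A
    unfolding set_integrable_def
  proof (rule Bochner_Integration.integrable_bound)
    show "integrable M (\<lambda>x. indicator A x *\<^sub>R k x)" using that by (simp add: set_integrable_def)
    show "(\<lambda>x. indicator A x *\<^sub>R f x) \<in> borel_measurable M" using assms that by simp
    show "AE x in M. norm (indicator A x *\<^sub>R f x) \<le> norm (indicator A x *\<^sub>R k x)"
      using assms(3) by (intro AE_I2) (simp add: indicator_def)
  qed
  show ?thesis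
    unfolding locally_integrable_def
  proof (intro conjI allI impI)
    fix K assume "compact K \<and> K \<subseteq> space M"
    with assms(1) obtain A where "A \<in> sets M" "K \<subseteq> A" "set_integrable M A k"
      by (rule locally_integrableE)
    then show "\<exists>A\<in>sets M. K \<subseteq> A \<and> set_integrable M A f" using f by blast
  qed (rule assms(2))
qed

lemma locally_integrable_add:
  assumes "locally_integrable M k" "locally_integrable M l"
  shows "locally_integrable M (\<lambda>x. k x + l x)"
  unfolding locally_integrable_def
proof (intro conjI allI impI)
  show "(\<lambda>x. k x + l x) \<in> borel_measurable M"
    using assms by (intro borel_measurable_add locally_integrable_measurable)
  fix K assume "compact K \<and> K \<subseteq> space M"
  then obtain A B where "A \<in> sets M" "K \<subseteq> A" "set_integrable M A k" "B \<in> sets M" "K \<subseteq> B" "set_integrable M B l"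
    using locally_integrableE[OF assms(1)] locally_integrableE[OF assms(2)] by metis
  then show "\<exists>A\<in>sets M. K \<subseteq> A \<and> set_integrable M A (\<lambda>x. k x + l x)"
    by (intro bexI[of _ "A \<inter> B"] conjI set_integral_add(1))
      (auto intro: set_integrable_subset[of M A k] set_integrable_subset[of M B l])
qed

lemma locally_integrable_cmult:
  assumes "locally_integrable M k"
  shows "locally_integrable M (\<lambda>x. c * k x)"
  unfolding locally_integrable_def
proof (intro conjI allI impI)
  show "(\<lambda>x. c * k x) \<in> borel_measurable M"
    by (intro borel_measurable_times borel_measurable_const locally_integrable_measurable[OF assms])
  fix K assume "compact K \<and> K \<subseteq> space M"
  with assms obtain A where "A \<in> sets M" "K \<subseteq> A" "set_integrable M A k"
    by (rule locally_integrableE)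
  then show "\<exists>A\<in>sets M. K \<subseteq> A \<and> set_integrable M A (\<lambda>x. c * k x)"
    by (intro bexI[of _ A] conjI set_integrable_mult_right)
qed

lemma integrable_imp_locally_integrable:
  assumes "integrable M k"
  shows "locally_integrable M k"
  unfolding locally_integrable_def
proof (intro conjI allI impI)
  show "k \<in> borel_measurable M" by (rule borel_measurable_integrable[OF assms])
  have "set_integrable M (space M) k"
    unfolding set_integrable_def by (rule integrable_mult_indicator[OF sets.top assms])
  then show "\<exists>A\<in>sets M. K \<subseteq> A \<and> set_integrable M A k" if "compact K \<and> K \<subseteq> space M" for K
    using that by (intro bexI[of _ "space M"]) simp_all
qed

text \<open>A pointwise factor covers constants, truncation by an indicator function, and
  multiplication by the weight \<open>u\<close> at once.\<close>

lemma locally_integrably_bounded_scaleI: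
  fixes F :: "'b::topological_space \<Rightarrow> 'a::euclidean_space set"
  assumes F: "set_measurable_fun M F" and c: "c \<in> borel_measurable M"
    and k: "\<And>x. x \<in> space M \<Longrightarrow> 0 \<le> k x" "AE x in M. F x \<subseteq> cball 0 (k x)"
    and ck: "locally_integrable M (\<lambda>x. \<bar>c x\<bar> * k x)"
  shows "locally_integrably_bounded M (\<lambda>x. (*\<^sub>R) (c x) ` F x)"
  unfolding locally_integrably_bounded_def
proof (intro conjI exI)
  show "set_measurable_fun M (\<lambda>x. (*\<^sub>R) (c x) ` F x)" by (rule set_measurable_fun_scale[OF F c])
  show "locally_integrable M (\<lambda>x. \<bar>c x\<bar> * k x)" by (rule ck)
  show "\<forall>x\<in>space M. 0 \<le> \<bar>c x\<bar> * k x" using k(1) by simp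
  show "AE x in M. (*\<^sub>R) (c x) ` F x \<subseteq> cball 0 (\<bar>c x\<bar> * k x)"
    using k(2)
  proof eventually_elim
    case (elim x)
    then show ?case by (auto simp: subset_eq intro!: mult_left_mono)
  qed
qed

lemma locally_integrably_bounded_scale:
  fixes F :: "'b::topological_space \<Rightarrow> 'a::euclidean_space set"
  assumes "locally_integrably_bounded M F"
  shows "locally_integrably_bounded M (\<lambda>x. (*\<^sub>R) c ` F x)"
proof -
  obtain k where k: "locally_integrable M k" "\<And>x. x \<in> space M \<Longrightarrow> 0 \<le> k x" "AE x in M. F x \<subseteq> cball 0 (k x)"
    and F: "set_measurable_fun M F"
    using assms unfolding locally_integrably_bounded_def by blast
  show ?thesis
    by (rule locally_integrably_bounded_scaleI[OF F _ k(2,3)]) (auto intro: locally_integrable_cmult k(1))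
qed

lemma locally_integrably_bounded_plus:
  fixes F G :: "'b::topological_space \<Rightarrow> 'a::euclidean_space set"
  assumes "locally_integrably_bounded M F" "locally_integrably_bounded M G"
  shows "locally_integrably_bounded M (\<lambda>x. F x + G x)"
proof -
  obtain k where k: "locally_integrable M k" "\<forall>x\<in>space M. 0 \<le> k x" "AE x in M. F x \<subseteq> cball 0 (k x)"
    and F: "set_measurable_fun M F"
    using assms(1) unfolding locally_integrably_bounded_def by blast
  obtain l where l: "locally_integrable M l" "\<forall>x\<in>space M. 0 \<le> l x" "AE x in M. G x \<subseteq> cball 0 (l x)"
    and G: "set_measurable_fun M G"
    using assms(2) unfolding locally_integrably_bounded_def by blast
  have "AE x in M. F x + G x \<subseteq> cball 0 (k x + l x)"
    using k(3) l(3)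
  proof eventually_elim
    case (elim x)
    show ?case
    proof
      fix v assume "v \<in> F x + G x"
      then obtain a b where "a \<in> F x" "b \<in> G x" "v = a + b" by (rule set_plus_elim)
      then show "v \<in> cball 0 (k x + l x)"
        using elim norm_triangle_mono[of a "k x" b "l x"] by (auto simp: subset_eq)
    qed
  qed
  then show ?thesis
    unfolding locally_integrably_bounded_def
    using set_measurable_fun_plus[OF F G] locally_integrable_add[OF k(1) l(1)] k(2) l(2)
    by (meson add_nonneg_nonneg)
qed

text \<open>\<open>\<Omega>\<close> need not be sigma-compact, nor its compact subsets measurable; the sets of
  \<open>compact_finite_exhaustion\<close> take the place of an exhaustion by compact sets.\<close>

lemma locally_integrable_slow_weight:
  fixes M :: "'a::{second_countable_topology,metric_space} measure" and b :: "'a \<Rightarrow> nat"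
  assumes k: "locally_integrable M k" "\<And>x. x \<in> space M \<Longrightarrow> 0 \<le> k x"
    and b: "b \<in> measurable M (count_space UNIV)"
  obtains u :: "'a \<Rightarrow> nat" where "u \<in> measurable M (count_space UNIV)"
    "\<And>j. \<exists>m. \<forall>x\<in>space M. u x \<le> j \<longrightarrow> b x \<le> m"
    "locally_integrable M (\<lambda>x. real (u x) * k x)"
proof -
  have km: "k \<in> borel_measurable M" using k(1) by (simp add: locally_integrable_def)
  \<comment> \<open>With k dM as measure, local integrability of \<open>k\<close> gives compact sets
    finite outer measure, and that of \<open>u k\<close> becomes a statement about integrals of
    \<open>u\<close>.\<close>
  define N where "N = density M (\<lambda>x. ennreal (k x))"
  have spN: "space N = space M" and seN: "sets N = sets M" by (simp_all add: N_def)
  have fin_outer: "outer_measure_of N K < \<infinity>" if "compact K" "K \<subseteq> space N" for K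
  proof -
    have "compact K \<and> K \<subseteq> space M" using that spN by simp
    with k(1) obtain A where A: "A \<in> sets M" "K \<subseteq> A" "set_integrable M A k"
      by (rule locally_integrableE)
    have "emeasure N A = (\<integral>\<^sup>+x. ennreal (indicator A x *\<^sub>R k x) \<partial>M)"
      unfolding N_def using A(1) km
      by (subst emeasure_density) (auto simp: indicator_def intro!: nn_integral_cong)
    also have "\<dots> = (\<integral>\<^sup>+x. ennreal (norm (indicator A x *\<^sub>R k x)) \<partial>M)"
      using k(2) by (intro nn_integral_cong) (simp add: indicator_def)
    also have "\<dots> < \<infinity>" using A(3) unfolding set_integrable_def integrable_iff_bounded by simp
    finally have "emeasure N A < \<infinity>" .
    moreover have "outer_measure_of N K \<le> outer_measure_of N A" by (rule outer_measure_of_mono[OF A(2)])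
    ultimately show ?thesis using A(1) seN by (simp add: order_le_less_trans)
  qed
  obtain A :: "nat \<Rightarrow> 'a set" where A: "range A \<subseteq> sets N" "incseq A" "\<And>i. emeasure N (A i) < \<infinity>"
    and hull: "\<And>K. compact K \<Longrightarrow> K \<subseteq> space N \<Longrightarrow> \<exists>i. \<exists>B\<in>sets N. K \<subseteq> B \<and> emeasure N (B - A i) = 0"
    using compact_finite_exhaustion[OF fin_outer] by metis
  have AN: "A i \<in> sets N" for i using A(1) by blast
  define E where "E n = {x \<in> space M. n < b x}" for n
  have E: "E n \<in> sets N" for n using b unfolding E_def seN by measurable
  \<comment> \<open>The sets \<open>E n\<close> decrease to the empty set and \<open>A i\<close> has
    finite measure, so continuity from above applies.\<close>
  have "\<exists>n0. \<forall>n\<ge>n0. emeasure N (A i \<inter> E n) \<le> ennreal ((1 / 2) ^ i)" for i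
  proof -
    have "(\<Inter>n. A i \<inter> E n) = {}" by (auto simp: E_def)
    moreover have "(\<lambda>n. emeasure N (A i \<inter> E n)) \<longlonglongrightarrow> emeasure N (\<Inter>n. A i \<inter> E n)"
    proof (rule Lim_emeasure_decseq)
      show "range (\<lambda>n. A i \<inter> E n) \<subseteq> sets N" using AN E by blast
      show "decseq (\<lambda>n. A i \<inter> E n)" by (auto simp: decseq_def E_def)
      show "emeasure N (A i \<inter> E n) \<noteq> \<infinity>" for n
        using A(3)[of i] emeasure_mono[of "A i \<inter> E n" "A i" N] AN by (auto simp: top_unique)
    qed
    ultimately have "(\<lambda>n. emeasure N (A i \<inter> E n)) \<longlonglongrightarrow> 0" by simp
    then have "\<forall>\<^sub>F n in sequentially. emeasure N (A i \<inter> E n) < ennreal ((1 / 2) ^ i)"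
      by (rule order_tendstoD(2)) simp
    then show ?thesis unfolding eventually_sequentially by (meson less_imp_le)
  qed
  then obtain f where f: "\<And>i n. f i \<le> n \<Longrightarrow> emeasure N (A i \<inter> E n) \<le> ennreal ((1 / 2) ^ i)" by metis
  \<comment> \<open>Summing the \<open>f j\<close> makes the thresholds monotone; the summand
    \<open>i\<close> makes them tend to infinity, so that only finitely many lie below a given
    \<open>t\<close>.\<close>
  define n where "n i = (\<Sum>j\<le>i. f j) + i" for i
  have fn: "f i \<le> n i" for i
  proof -
    have "f i \<le> (\<Sum>j\<le>i. f j)" by (rule member_le_sum) auto
    then show ?thesis by (simp add: n_def)
  qed
  have n_mono: "n i \<le> n j" if "i \<le> j" for i j
    unfolding n_def using that by (intro add_mono sum_mono2) auto
  have i_le_n: "i \<le> n i" for i by (simp add: n_def)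
  \<comment> \<open>Counting the thresholds passed by \<open>b x\<close> makes \<open>u\<close> the
    sum of the indicator functions of the sets \<open>E (n i)\<close>.\<close>
  define g where "g t = card {i. n i < t}" for t
  have fin: "finite {i. n i < t}" for t
    by (rule finite_subset[of _ "{..t}"]) (use i_le_n in \<open>auto intro: order_trans less_imp_le\<close>)
  define u where "u x = g (b x)" for x
  have um: "u \<in> measurable M (count_space UNIV)"
    unfolding u_def by (rule measurable_compose[OF b]) simp
  \<comment> \<open>Exceeding \<open>n j\<close> means exceeding all of the j + 1 thresholds with
    index at most \<open>j\<close>, which forces \<open>u x\<close> to be at least j + 1.\<close>
  have small: "b x \<le> n j" if "u x \<le> j" for x j
  proof (rule ccontr)
    assume "\<not> b x \<le> n j"
    then have "{..j} \<subseteq> {i. n i < b x}" using n_mono by (force simp: not_le)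
    then have "card {..j} \<le> u x" unfolding u_def g_def by (intro card_mono fin)
    then show False using that by simp
  qed
  have uE: "ennreal (real (u x)) = (\<Sum>i. indicator (E (n i)) x)" if "x \<in> space M" for x
  proof -
    have "(\<Sum>i. indicator (E (n i)) x) = (\<Sum>i\<in>{i. n i < b x}. indicator (E (n i)) x :: ennreal)"
      by (intro suminf_finite fin) (auto simp: E_def)
    also have "\<dots> = (\<Sum>i\<in>{i. n i < b x}. 1)" using that by (intro sum.cong) (auto simp: E_def)
    finally show ?thesis by (simp add: u_def g_def ennreal_of_nat_eq_real_of_nat)
  qed
  have A_fin: "(\<integral>\<^sup>+x. ennreal (real (u x)) * indicator (A j) x \<partial>N) < \<infinity>" for j
  proof -
    have "(\<integral>\<^sup>+x. ennreal (real (u x)) * indicator (A j) x \<partial>N) =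
        (\<integral>\<^sup>+x. (\<Sum>i. indicator (A j \<inter> E (n i)) x) \<partial>N)"
    proof (intro nn_integral_cong)
      fix x assume "x \<in> space N"
      then have "ennreal (real (u x)) * indicator (A j) x = (\<Sum>i. indicator (E (n i)) x) * indicator (A j) x"
        by (simp add: uE spN)
      also have "\<dots> = (\<Sum>i. indicator (A j \<inter> E (n i)) x)"
        by (cases "x \<in> A j") (auto simp: indicator_def intro!: arg_cong[where f = suminf])
      finally show "ennreal (real (u x)) * indicator (A j) x = (\<Sum>i. indicator (A j \<inter> E (n i)) x)" .
    qed
    also have "\<dots> = (\<Sum>i. emeasure N (A j \<inter> E (n i)))"
      using AN E by (subst nn_integral_suminf) auto
    \<comment> \<open>Finitely many terms are estimated by the measure of \<open>A j\<close>; from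
      index \<open>j\<close> on, \<open>A j \<subseteq> A i\<close> and the choice of the thresholds
      gives a geometric series.\<close>
    also have "\<dots> \<le> (\<Sum>i. (if i < j then emeasure N (A j) else 0) + ennreal ((1 / 2) ^ i))"
    proof (rule suminf_le)
      fix i
      show "emeasure N (A j \<inter> E (n i)) \<le> (if i < j then emeasure N (A j) else 0) + ennreal ((1 / 2) ^ i)"
      proof (cases "i < j")
        case True
        have "emeasure N (A j \<inter> E (n i)) \<le> emeasure N (A j)" using AN by (intro emeasure_mono) auto
        then show ?thesis using True by (simp add: add_increasing2)
      next
        case False
        then have "A j \<subseteq> A i" using A(2) by (simp add: incseqD)
        then have "emeasure N (A j \<inter> E (n i)) \<le> emeasure N (A i \<inter> E (n i))"
          using AN E by (intro emeasure_mono) auto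
        then show ?thesis using f[OF fn] False order_trans by fastforce
      qed
    qed auto
    also have "\<dots> = (\<Sum>i. if i < j then emeasure N (A j) else 0) + (\<Sum>i. ennreal ((1 / 2) ^ i))"
      by (rule suminf_add[symmetric]) auto
    also have "(\<Sum>i. if i < j then emeasure N (A j) else 0) = (\<Sum>i<j. emeasure N (A j))"
      by (subst suminf_finite[of "{..<j}"]) auto
    also have "(\<Sum>i. ennreal ((1 / 2) ^ i)) = ennreal (\<Sum>i. (1 / 2) ^ i)"
      by (rule suminf_ennreal2) (auto simp: summable_geometric)
    also have "(\<Sum>i<j. emeasure N (A j)) + ennreal (\<Sum>i. (1 / 2) ^ i) < \<infinity>"
      using A(3)[of j] by (simp add: ennreal_mult_less_top of_nat_less_top)
    finally show ?thesis .
  qed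
  have uk: "locally_integrable M (\<lambda>x. real (u x) * k x)"
    unfolding locally_integrable_def
  proof (intro conjI allI impI)
    have um': "(\<lambda>x. real (u x)) \<in> borel_measurable M"
      by (rule measurable_compose[OF um]) simp
    show ukm: "(\<lambda>x. real (u x) * k x) \<in> borel_measurable M" using um' km by measurable
    fix K assume K: "compact K \<and> K \<subseteq> space M"
    then obtain j B where B: "B \<in> sets N" "K \<subseteq> B" "emeasure N (B - A j) = 0" using hull spN by metis
    have "(\<integral>\<^sup>+x. ennreal (norm (indicator B x *\<^sub>R (real (u x) * k x))) \<partial>M) =
        (\<integral>\<^sup>+x. ennreal (k x) * (ennreal (real (u x)) * indicator B x) \<partial>M)"
      using k(2) by (intro nn_integral_cong) (simp add: indicator_def ennreal_mult mult.commute)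
    also have "\<dots> = (\<integral>\<^sup>+x. ennreal (real (u x)) * indicator B x \<partial>N)"
      unfolding N_def using km um' B(1) seN by (subst nn_integral_density) auto
    also have "\<dots> \<le> (\<integral>\<^sup>+x. ennreal (real (u x)) * indicator (A j) x +
        ennreal (real (u x)) * indicator (B - A j) x \<partial>N)"
      by (intro nn_integral_mono) (simp add: indicator_def)
    also have "\<dots> = (\<integral>\<^sup>+x. ennreal (real (u x)) * indicator (A j) x \<partial>N) +
        (\<integral>\<^sup>+x. ennreal (real (u x)) * indicator (B - A j) x \<partial>N)"
      using um' AN B(1) by (intro nn_integral_add) (auto simp: N_def)
    also have "(\<integral>\<^sup>+x. ennreal (real (u x)) * indicator (B - A j) x \<partial>N) = 0"
      using B AN by (intro nn_integral_null_set) (auto simp: null_sets_def)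
    also have "(\<integral>\<^sup>+x. ennreal (real (u x)) * indicator (A j) x \<partial>N) + 0 < \<infinity>" using A_fin[of j] by simp
    finally have "set_integrable M B (\<lambda>x. real (u x) * k x)"
      unfolding set_integrable_def integrable_iff_bounded using ukm B(1) seN by auto
    then show "\<exists>A\<in>sets M. K \<subseteq> A \<and> set_integrable M A (\<lambda>x. real (u x) * k x)"
      using B seN by blast
  qed
  show thesis
  proof (rule that[OF um _ uk])
    show "\<exists>m. \<forall>x\<in>space M. u x \<le> j \<longrightarrow> b x \<le> m" for j
      using small[of _ j] by (intro exI[of _ "n j"] ballI impI)
  qed
qed

section \<open>The interpolation estimate\<close>

text \<open>The required radii \<open>\<alpha>\<close> and \<open>\<beta>\<close> have weighted
  product \<open>r\<close>, the powers of \<open>s\<close> cancelling. A vector with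
  \<open>interp_fun\<close> at most \<open>r\<close> cannot exceed both radii, hence lies in one of
  the balls and so in their sum \<open>C\<close>, which is closed, convex and symmetric; the bipolar
  theorem carries the inclusion over to the ball of \<open>interp_norm\<close>.\<close>

lemma interp_K_decomposition:
  fixes \<rho>0 \<rho>1 :: "'b \<Rightarrow> 'a::euclidean_space \<Rightarrow> real"
  assumes N: "is_norm (\<rho>0 x)" "is_norm (\<rho>1 x)" and \<theta>: "0 < \<theta>" "\<theta> < 1"
    and nonneg: "0 \<le> a" "0 \<le> b"
    and v: "interp_norm \<theta> \<rho>0 \<rho>1 x v \<le> a powr (1 - \<theta>) * b powr \<theta>" and s: "0 < s"
  obtains g h where "v = g + h" "\<rho>0 x g \<le> s powr \<theta> * a" "\<rho>1 x h \<le> s powr - (1 - \<theta>) * b"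
proof -
  let ?N = "interp_fun \<theta> \<rho>0 \<rho>1 x"
  let ?R = "interp_norm \<theta> \<rho>0 \<rho>1 x"
  note R = is_norm_interp_norm(1)[where ?\<rho>0.0 = \<rho>0 and ?\<rho>1.0 = \<rho>1, OF N \<theta>]
  have q: "quasi_norm ?N" using N \<theta> by (intro quasi_norm_interp_fun is_norm_imp_quasi_norm)
  define r where "r = a powr (1 - \<theta>) * b powr \<theta>"
  show thesis
  proof (cases "a = 0 \<or> b = 0")
    case True
    then have "?R v \<le> 0" using v \<theta> by auto
    then have "v = 0" using is_normD(1,2)[OF R, of v] by linarith
    then show thesis
      using that[of 0 0] nonneg by (simp add: is_norm_zero[OF N(1)] is_norm_zero[OF N(2)])
  next
    case False
    then have ab: "0 < a" "0 < b" using nonneg by auto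
    then have r: "0 < r" by (simp add: r_def)
    define \<alpha> \<beta> where "\<alpha> = s powr \<theta> * a" and "\<beta> = s powr - (1 - \<theta>) * b"
    have \<alpha>\<beta>: "0 < \<alpha>" "0 < \<beta>" using ab s by (auto simp: \<alpha>_def \<beta>_def)
    have prod: "\<alpha> powr (1 - \<theta>) * \<beta> powr \<theta> = r"
    proof -
      have "\<alpha> powr (1 - \<theta>) * \<beta> powr \<theta> =
          (s powr (\<theta> * (1 - \<theta>)) * s powr (- (1 - \<theta>) * \<theta>)) * r"
        using ab s by (simp add: \<alpha>_def \<beta>_def r_def powr_mult powr_powr)
      also have "s powr (\<theta> * (1 - \<theta>)) * s powr (- (1 - \<theta>) * \<theta>) = s powr 0"
        unfolding powr_add[symmetric] by (simp add: algebra_simps)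
      finally show ?thesis using s by simp
    qed
    define C where "C = {v. \<rho>0 x v \<le> \<alpha>} + {v. \<rho>1 x v \<le> \<beta>}"
    have CK: "C \<in> Kbcs" unfolding C_def using N \<alpha>\<beta> by (intro Kbcs_plus Kbcs_norm_ball) auto
    then have CK': "(*\<^sub>R) (1 / r) ` C \<in> Kbcs" by (rule Kbcs_scale)
    have sub: "{u. ?N u \<le> 1} \<subseteq> (*\<^sub>R) (1 / r) ` C"
    proof
      fix u assume "u \<in> {u. ?N u \<le> 1}"
      then have u: "?N (r *\<^sub>R u) \<le> r" using r by (simp add: quasi_normD(3)[OF q])
      have "\<rho>0 x (r *\<^sub>R u) \<le> \<alpha> \<or> \<rho>1 x (r *\<^sub>R u) \<le> \<beta>"
      proof (rule ccontr)
        assume "\<not> ?thesis"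
        then have gt: "\<alpha> < \<rho>0 x (r *\<^sub>R u)" "\<beta> < \<rho>1 x (r *\<^sub>R u)" by auto
        have "\<alpha> powr (1 - \<theta>) * \<beta> powr \<theta> < \<rho>0 x (r *\<^sub>R u) powr (1 - \<theta>) * \<rho>1 x (r *\<^sub>R u) powr \<theta>"
          using gt \<alpha>\<beta> \<theta> by (intro mult_strict_mono powr_less_mono2) auto
        then show False using u prod by (simp add: interp_fun_def)
      qed
      then have "r *\<^sub>R u \<in> C"
      proof
        assume "\<rho>0 x (r *\<^sub>R u) \<le> \<alpha>"
        then have "r *\<^sub>R u + 0 \<in> C"
          unfolding C_def using \<alpha>\<beta> by (intro set_plus_intro) (simp_all add: is_norm_zero[OF N(2)])
        then show ?thesis by simp
      next
        assume "\<rho>1 x (r *\<^sub>R u) \<le> \<beta>"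
        then have "0 + r *\<^sub>R u \<in> C"
          unfolding C_def using \<alpha>\<beta> by (intro set_plus_intro) (simp_all add: is_norm_zero[OF N(1)])
        then show ?thesis by simp
      qed
      then show "u \<in> (*\<^sub>R) (1 / r) ` C" using r by (intro image_eqI[of _ _ "r *\<^sub>R u"]) simp_all
    qed
    have "?R ((1 / r) *\<^sub>R v) \<le> 1" using v r by (simp add: is_normD(3)[OF R] r_def[symmetric])
    then have "polar_dual (polar_dual ?N) ((1 / r) *\<^sub>R v) \<le> 1" unfolding interp_norm_def .
    then have "(1 / r) *\<^sub>R v \<in> (*\<^sub>R) (1 / r) ` C"
    proof (rule polar_bidual_ball_subset[OF q _ _ _ sub, rotated -1])
      show "closed ((*\<^sub>R) (1 / r) ` C)" "convex ((*\<^sub>R) (1 / r) ` C)" using CK' by (simp_all add: Kbcs_def)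
      show "- w \<in> (*\<^sub>R) (1 / r) ` C" if "w \<in> (*\<^sub>R) (1 / r) ` C" for w by (rule Kbcs_minus[OF CK' that])
    qed
    then obtain w where "w \<in> C" "(1 / r) *\<^sub>R v = (1 / r) *\<^sub>R w" by blast
    then have "v \<in> C" using r by simp
    then obtain g h where "\<rho>0 x g \<le> \<alpha>" "\<rho>1 x h \<le> \<beta>" "v = g + h"
      unfolding C_def by (auto elim: set_plus_elim)
    then show thesis using that unfolding \<alpha>_def \<beta>_def by simp
  qed
qed

lemma set_size_interp_norm_le:
  fixes \<rho>0 \<rho>1 :: "'b \<Rightarrow> 'a::euclidean_space \<Rightarrow> real"
  assumes N: "is_norm (\<rho>0 y)" "is_norm (\<rho>1 y)" and \<theta>: "0 < \<theta>" "\<theta> < 1"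
    and K: "F \<in> Kbcs" "G \<in> Kbcs" "H \<in> Kbcs"
    and sub: "\<And>s. 0 < s \<Longrightarrow> F \<subseteq> (*\<^sub>R) (s powr \<theta>) ` G + (*\<^sub>R) (s powr - (1 - \<theta>)) ` H"
  shows "set_size (interp_norm \<theta> \<rho>0 \<rho>1 y) F \<le>
    2 ^ Suc DIM('a) * (set_size (\<rho>0 y) G powr (1 - \<theta>) * set_size (\<rho>1 y) H powr \<theta>)"
proof (rule set_size_least[OF K(1)])
  fix w assume w: "w \<in> F"
  show "interp_norm \<theta> \<rho>0 \<rho>1 y w \<le>
      2 ^ Suc DIM('a) * (set_size (\<rho>0 y) G powr (1 - \<theta>) * set_size (\<rho>1 y) H powr \<theta>)"
  proof (rule interp_le_of_K_decomposition[OF N is_norm_interp_norm(1)[where ?\<rho>0.0 = \<rho>0 and ?\<rho>1.0 = \<rho>1, OF N \<theta>] \<theta>])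
    show "interp_norm \<theta> \<rho>0 \<rho>1 y v \<le> \<rho>0 y v powr (1 - \<theta>) * \<rho>1 y v powr \<theta>" for v
      by (rule is_norm_interp_norm(2)[where ?\<rho>0.0 = \<rho>0 and ?\<rho>1.0 = \<rho>1, OF N \<theta>])
    show "0 \<le> set_size (\<rho>0 y) G" "0 \<le> set_size (\<rho>1 y) H" using N K by (auto intro: set_size_nonneg)
    fix s :: real assume s: "0 < s"
    then have "w \<in> (*\<^sub>R) (s powr \<theta>) ` G + (*\<^sub>R) (s powr - (1 - \<theta>)) ` H" using sub w by blast
    then obtain g h where gh: "g \<in> G" "h \<in> H" "w = s powr \<theta> *\<^sub>R g + s powr - (1 - \<theta>) *\<^sub>R h"
      by (auto elim!: set_plus_elim)
    have "\<rho>0 y (s powr \<theta> *\<^sub>R g) \<le> s powr \<theta> * set_size (\<rho>0 y) G"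
      using le_set_size[OF N(1) K(2) gh(1)] by (simp add: is_normD(3)[OF N(1)] mult_left_mono)
    moreover have "\<rho>1 y (s powr - (1 - \<theta>) *\<^sub>R h) \<le> s powr - (1 - \<theta>) * set_size (\<rho>1 y) H"
      using le_set_size[OF N(2) K(3) gh(2)] is_normD(1)[OF N(2), of h] unfolding is_normD(3)[OF N(2)] by (intro mult_mono) auto
    ultimately show "\<exists>g h. w = g + h \<and> \<rho>0 y g \<le> s powr \<theta> * set_size (\<rho>0 y) G \<and>
        \<rho>1 y h \<le> s powr - (1 - \<theta>) * set_size (\<rho>1 y) H" using gh(3) by blast
  qed
qed

text \<open>Hoelder's inequality in its pointwise form: after division by \<open>\<alpha>\<close>
  and \<open>\<beta>\<close>, Young's inequality with weights \<open>\<kappa>\<close> and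
  \<open>\<mu>\<close> turns the product into a sum of two functions of integral at most 1. The
  division is the reason for asking that \<open>\<alpha>\<close> and \<open>\<beta>\<close> be
  positive.\<close>

lemma interp_nn_integral_le:
  fixes a b f :: "'b \<Rightarrow> real"
  assumes \<theta>: "0 < \<theta>" "\<theta> < 1" and q: "0 < q" "0 < q0" "0 < q1" "1 / q = (1 - \<theta>) / q0 + \<theta> / q1"
    and meas: "a \<in> borel_measurable M" "b \<in> borel_measurable M"
    and nonneg: "\<And>x. x \<in> space M \<Longrightarrow> 0 \<le> a x" "\<And>x. x \<in> space M \<Longrightarrow> 0 \<le> b x" "\<And>x. x \<in> space M \<Longrightarrow> 0 \<le> f x"
    and f: "\<And>x. x \<in> space M \<Longrightarrow> f x \<le> c * (a x powr (1 - \<theta>) * b x powr \<theta>)"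
    and pos: "0 < \<alpha>" "0 < \<beta>" "0 \<le> c"
    and int: "(\<integral>\<^sup>+x. ennreal (a x powr q0) \<partial>M) \<le> ennreal (\<alpha> powr q0)"
      "(\<integral>\<^sup>+x. ennreal (b x powr q1) \<partial>M) \<le> ennreal (\<beta> powr q1)"
  shows "(\<integral>\<^sup>+x. ennreal (f x powr q) \<partial>M) \<le> ennreal ((c * (\<alpha> powr (1 - \<theta>) * \<beta> powr \<theta>)) powr q)"
proof -
  \<comment> \<open>These weights turn the powers \<open>q0\<close> and \<open>q1\<close> into the
    exponents of \<open>f powr q\<close>; they sum to 1 by the formula for 1/q.\<close>
  define \<kappa> \<mu> where "\<kappa> = q * (1 - \<theta>) / q0" and "\<mu> = q * \<theta> / q1"
  have \<kappa>\<mu>: "0 < \<kappa>" "0 < \<mu>" using \<theta> q by (auto simp: \<kappa>_def \<mu>_def)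
  have "\<kappa> + \<mu> = q * (1 / q)" unfolding q(4) \<kappa>_def \<mu>_def by (simp add: distrib_left)
  then have sum1: "\<kappa> + \<mu> = 1" using q(1) by simp
  define K where "K = (c * (\<alpha> powr (1 - \<theta>) * \<beta> powr \<theta>)) powr q"
  have K0: "0 \<le> K" by (simp add: K_def)
  define A B where "A = K * \<kappa> * \<alpha> powr - q0" and "B = K * \<mu> * \<beta> powr - q1"
  have AB: "0 \<le> A" "0 \<le> B" using K0 \<kappa>\<mu> by (auto simp: A_def B_def)
  have pw: "f x powr q \<le> A * (a x powr q0) + B * (b x powr q1)" if x: "x \<in> space M" for x
  proof (cases "a x = 0 \<or> b x = 0")
    case True
    then have "f x = 0" using f[OF x] nonneg(3)[OF x] by auto
    then show ?thesis using AB by simp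
  next
    case False
    then have ab: "0 < a x" "0 < b x" using nonneg(1,2)[OF x] by (auto simp: less_le)
    have "f x powr q \<le> (c * (a x powr (1 - \<theta>) * b x powr \<theta>)) powr q"
      using q(1) nonneg(3)[OF x] f[OF x] by (intro powr_mono2) auto
    also have "\<dots> = K * (((a x / \<alpha>) powr q0) powr \<kappa> * ((b x / \<beta>) powr q1) powr \<mu>)"
    proof -
      have e: "q0 * \<kappa> = (1 - \<theta>) * q" "q1 * \<mu> = \<theta> * q" using q by (auto simp: \<kappa>_def \<mu>_def)
      show ?thesis
        unfolding K_def powr_powr e using ab pos by (simp add: powr_mult powr_divide powr_powr)
    qed
    also have "\<dots> \<le> K * (\<kappa> * (a x / \<alpha>) powr q0 + \<mu> * (b x / \<beta>) powr q1)"
      using \<kappa>\<mu> sum1 ab pos K0 by (intro mult_left_mono Youngs_inequality_0) auto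
    also have "\<dots> = A * (a x powr q0) + B * (b x powr q1)"
      using ab pos by (simp add: A_def B_def powr_divide powr_minus_divide distrib_left mult.assoc)
    finally show ?thesis .
  qed
  have "(\<integral>\<^sup>+x. ennreal (f x powr q) \<partial>M) \<le>
      (\<integral>\<^sup>+x. ennreal A * ennreal (a x powr q0) + ennreal B * ennreal (b x powr q1) \<partial>M)"
    using pw AB by (intro nn_integral_mono) (simp flip: ennreal_mult ennreal_plus add: ennreal_leI)
  also have "\<dots> = ennreal A * (\<integral>\<^sup>+x. ennreal (a x powr q0) \<partial>M) + ennreal B * (\<integral>\<^sup>+x. ennreal (b x powr q1) \<partial>M)"
    using meas by (simp add: nn_integral_add nn_integral_cmult)
  also have "\<dots> \<le> ennreal A * ennreal (\<alpha> powr q0) + ennreal B * ennreal (\<beta> powr q1)"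
    using int by (intro add_mono mult_left_mono) auto
  also have "\<dots> = ennreal (A * \<alpha> powr q0 + B * \<beta> powr q1)"
    using AB by (simp flip: ennreal_mult ennreal_plus)
  also have "A * \<alpha> powr q0 + B * \<beta> powr q1 = K * (\<kappa> + \<mu>)"
    using pos by (simp add: A_def B_def powr_minus_divide distrib_left)
  also have "\<dots> = K" using sum1 by simp
  finally show ?thesis by (simp add: K_def)
qed

lemma ennreal_root_le_iff:
  assumes "0 < p" "0 \<le> c"
  shows "ennreal_root p a \<le> ennreal c \<longleftrightarrow> a \<le> ennreal (c powr p)"
proof (cases a)
  case (real t)
  have "t powr (1 / p) \<le> c \<longleftrightarrow> t \<le> c powr p"
  proof
    assume "t powr (1 / p) \<le> c"
    then have "(t powr (1 / p)) powr p \<le> c powr p" using assms by (intro powr_mono2) auto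
    then show "t \<le> c powr p" using assms real by (simp add: powr_powr)
  next
    assume "t \<le> c powr p"
    then have "t powr (1 / p) \<le> (c powr p) powr (1 / p)" using assms real by (intro powr_mono2) auto
    then show "t powr (1 / p) \<le> c" using assms by (simp add: powr_powr)
  qed
  then show ?thesis using real assms by (simp add: ennreal_root_def ennreal_le_iff)
qed (use assms in \<open>simp add: ennreal_root_def top_unique\<close>)

lemma LK_norm_le_iff:
  assumes "0 < p" "0 \<le> c"
  shows "LK_norm M p \<rho> F \<le> ennreal c \<longleftrightarrow>
    (\<integral>\<^sup>+x. ennreal (set_size (\<rho> x) (F x) powr p) \<partial>M) \<le> ennreal (c powr p)"
  unfolding LK_norm_def by (rule ennreal_root_le_iff[OF assms])

lemma scale_one_image: "(*\<^sub>R) 1 ` S = (S :: 'a::real_vector set)"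
  by simp

lemma scale_zero_image: "S \<noteq> {} \<Longrightarrow> (*\<^sub>R) 0 ` S = {0 :: 'a::real_vector}"
  by auto

lemma is_norm_norm: "is_norm (norm :: 'a::real_normed_vector \<Rightarrow> real)"
  by (simp add: is_norm_def norm_triangle_ineq)

text \<open>A positive upper bound \<open>J\<close> replaces the norm of \<open>F\<close>, and
  \<open>M0 + 1\<close>, \<open>M1 + 1\<close> replace \<open>M0\<close>, \<open>M1\<close>, so that
  the normalization in Hoelder's inequality never divides by zero.\<close>

lemma interp_operator_bound:
  fixes M :: "'b::{second_countable_topology,metric_space} measure"
    and \<rho>0 \<rho>1 :: "'b \<Rightarrow> 'a::euclidean_space \<Rightarrow> real"
  assumes sf: "sigma_finite_measure M"
    and exps: "0 < p0" "0 < p1" "0 < q0" "0 < q1" "0 < p" "0 < q"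
    and \<theta>: "0 < \<theta>" "\<theta> < 1" and p: "1 / p = (1 - \<theta>) / p0 + \<theta> / p1" and q: "1 / q = (1 - \<theta>) / q0 + \<theta> / q1"
    and \<rho>: "norm_function M \<rho>0" "norm_function M \<rho>1"
    and X: "X = {F. locally_integrably_bounded M F}" and TX: "\<And>F. F \<in> X \<Longrightarrow> T F \<in> X"
    and lin: "linear_operator_on M X T" and mono: "monotone_operator_on M X T"
    and M01: "0 \<le> M0" "0 \<le> M1"
    and b0: "\<And>F. F \<in> X \<Longrightarrow> LK_norm M q0 \<rho>0 (T F) \<le> ennreal M0 * LK_norm M p0 \<rho>0 F"
    and b1: "\<And>F. F \<in> X \<Longrightarrow> LK_norm M q1 \<rho>1 (T F) \<le> ennreal M1 * LK_norm M p1 \<rho>1 F"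
    and F: "F \<in> X" and J: "0 < J" "LK_norm M p (interp_norm \<theta> \<rho>0 \<rho>1) F \<le> ennreal J"
  shows "LK_norm M q (interp_norm \<theta> \<rho>0 \<rho>1) (T F) \<le>
    ennreal (2 ^ Suc DIM('a) * ((M0 + 1) powr (1 - \<theta>) * (M1 + 1) powr \<theta>) * J)"
proof -
  let ?R = "interp_norm \<theta> \<rho>0 \<rho>1"
  have \<rho>R: "norm_function M ?R" by (rule norm_function_interp_norm[OF \<rho> \<theta>])
  have N0: "is_norm (\<rho>0 x)" and N1: "is_norm (\<rho>1 x)" and NR: "is_norm (?R x)" if "x \<in> space M" for x
    using \<rho> \<rho>R that by (auto simp: norm_function_def)
  have XD: "set_measurable_fun M F" if "F \<in> X" for F
    using that by (simp add: X locally_integrably_bounded_def)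
  note XK = set_measurable_funD(1)[OF XD]
  have T_mono: "T F y \<subseteq> T G y" if "F \<in> X" "G \<in> X" "\<And>x. x \<in> space M \<Longrightarrow> F x \<subseteq> G x" "y \<in> space M" for F G y
    using mono that unfolding monotone_operator_on_def by blast
  have T_plus: "T (\<lambda>x. F x + G x) y = T F y + T G y" if "F \<in> X" "G \<in> X" "y \<in> space M" for F G y
    using lin that unfolding linear_operator_on_def by blast
  have T_scale: "T (\<lambda>x. (*\<^sub>R) c ` F x) y = (*\<^sub>R) c ` T F y" if "F \<in> X" "y \<in> space M" for F c y
    using lin that unfolding linear_operator_on_def by blast
  have X_plus: "(\<lambda>x. F x + G x) \<in> X" if "F \<in> X" "G \<in> X" for F G
    using that unfolding X mem_Collect_eq by (rule locally_integrably_bounded_plus)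
  have X_scale: "(\<lambda>x. (*\<^sub>R) c ` F x) \<in> X" if "F \<in> X" for F c
    using that unfolding X mem_Collect_eq by (rule locally_integrably_bounded_scale)

  \<comment> \<open>The size of \<open>F\<close> and the endpoint balls\<close>
  obtain k where k: "locally_integrable M k" "\<And>x. x \<in> space M \<Longrightarrow> 0 \<le> k x" "AE x in M. F x \<subseteq> cball 0 (k x)"
    using F unfolding X locally_integrably_bounded_def by blast
  define r where "r = (\<lambda>x. set_size (?R x) (F x))"
  have rm: "r \<in> borel_measurable M" unfolding r_def by (rule set_size_measurable[OF \<rho>R XD[OF F]])
  have r0: "0 \<le> r x" if "x \<in> space M" for x
    unfolding r_def by (rule set_size_nonneg[OF NR[OF that] XK[OF F that]])
  have r_int: "(\<integral>\<^sup>+x. ennreal (r x powr p) \<partial>M) \<le> ennreal (J powr p)"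
    using J(2) unfolding r_def by (subst (asm) LK_norm_le_iff) (use exps J in auto)

  \<comment> \<open>The exponents give \<open>g0\<close> and \<open>g1\<close> the weighted product
    \<open>r\<close>, by the formula for 1/p, while \<open>g0 powr p0\<close> and
    \<open>g1 powr p1\<close> both equal \<open>r powr p\<close>.\<close>
  define g0 g1 where "g0 = (\<lambda>x. r x powr (p / p0))" and "g1 = (\<lambda>x. r x powr (p / p1))"
  have gm: "g0 \<in> borel_measurable M" "g1 \<in> borel_measurable M"
    using rm unfolding g0_def g1_def by measurable
  have g_nonneg: "0 \<le> g0 x" "0 \<le> g1 x" for x by (simp_all add: g0_def g1_def)
  have interp_p: "(s powr (p / p0)) powr (1 - \<theta>) * (s powr (p / p1)) powr \<theta> = s" if "0 \<le> s" for s
  proof -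
    have "p / p0 * (1 - \<theta>) + p / p1 * \<theta> = p * (1 / p)" unfolding p by (simp add: distrib_left)
    then have "p / p0 * (1 - \<theta>) + p / p1 * \<theta> = 1" using exps by simp
    then show ?thesis using that unfolding powr_powr powr_add[symmetric] by simp
  qed
  define G where "G = (\<lambda>x. {v. \<rho>0 x v \<le> g0 x})"
  define H where "H = (\<lambda>x. {v. \<rho>1 x v \<le> g1 x})"
  have Gm: "set_measurable_fun M G" and Hm: "set_measurable_fun M H"
    unfolding G_def H_def using gm \<rho> by (auto intro!: set_measurable_fun_norm_ball simp: g0_def g1_def)

  \<comment> \<open>Euclidean size of the balls and the slow weight\<close>
  have "\<exists>w. w \<in> borel_measurable M \<and> (\<forall>x. 0 < w x) \<and> integrable M (w :: 'b \<Rightarrow> real)"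
    by (rule sigma_finite_measure.obtain_positive_integrable_function[OF sf]) blast
  then obtain w :: "'b \<Rightarrow> real" where w: "w \<in> borel_measurable M" "\<And>x. 0 < w x" "integrable M w"
    by blast
  define t where "t = (\<lambda>x. set_size norm (G x) + set_size norm (H x))"
  have nf: "norm_function M (\<lambda>_. norm :: 'a \<Rightarrow> real)"
    by (simp add: norm_function_def is_norm_norm)
  have tm: "t \<in> borel_measurable M"
    unfolding t_def using set_size_measurable[OF nf Gm] set_size_measurable[OF nf Hm] by measurable
  \<comment> \<open>\<open>b\<close> measures the balls against the positive integrable
    \<open>w\<close>: where \<open>b\<close> is at most \<open>n\<close>, both lie in the Euclidean
    ball of radius \<open>n w\<close>.\<close>
  define b where "b = (\<lambda>x. nat \<lceil>t x / w x\<rceil>)"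
  have bm: "b \<in> measurable M (count_space UNIV)" unfolding b_def using tm w(1) by measurable
  have t_le: "t x \<le> real (b x) * w x" for x
  proof -
    have "t x / w x \<le> real (b x)" unfolding b_def by (rule real_nat_ceiling_ge)
    then show ?thesis using w(2)[of x] by (simp add: divide_le_eq)
  qed
  have GHb: "G x \<subseteq> cball 0 (real (b x) * w x)" "H x \<subseteq> cball 0 (real (b x) * w x)" if x: "x \<in> space M" for x
  proof -
    note GK = set_measurable_funD(1)[OF Gm x] and HK = set_measurable_funD(1)[OF Hm x]
    have "norm v \<le> real (b x) * w x" if "v \<in> G x" for v
      using le_set_size[OF is_norm_norm GK that] set_size_nonneg[OF is_norm_norm HK] t_le[of x]
      unfolding t_def by linarith
    then show "G x \<subseteq> cball 0 (real (b x) * w x)" by auto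
    have "norm v \<le> real (b x) * w x" if "v \<in> H x" for v
      using le_set_size[OF is_norm_norm HK that] set_size_nonneg[OF is_norm_norm GK] t_le[of x]
      unfolding t_def by linarith
    then show "H x \<subseteq> cball 0 (real (b x) * w x)" by auto
  qed
  have "\<exists>u::'b \<Rightarrow> nat. u \<in> measurable M (count_space UNIV) \<and>
      (\<forall>j. \<exists>m. \<forall>x\<in>space M. u x \<le> j \<longrightarrow> b x \<le> m) \<and> locally_integrable M (\<lambda>x. real (u x) * k x)"
    by (rule locally_integrable_slow_weight[OF k(1,2) bm]) (assumption, blast)
  then obtain u :: "'b \<Rightarrow> nat" where um: "u \<in> measurable M (count_space UNIV)"
    and ub: "\<And>j. \<exists>m. \<forall>x\<in>space M. u x \<le> j \<longrightarrow> b x \<le> m"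
    and uk: "locally_integrable M (\<lambda>x. real (u x) * k x)"
    by blast

  \<comment> \<open>Truncations and their membership in \<open>X\<close>\<close>
  define E where "E m = {x \<in> space M. u x \<le> m}" for m
  have E: "E m \<in> sets M" for m unfolding E_def using um by measurable
  \<comment> \<open>Written as a scaling by the indicator function, truncation inherits
    measurability and integrable bounds from the scaling lemmas.\<close>
  define cut where "cut A S = (\<lambda>x. (*\<^sub>R) (indicat_real A x) ` S x)" for A and S :: "'b \<Rightarrow> 'a set"
  have cut_in: "cut A S x = S x" if "x \<in> A" for A S x
    using that by (simp add: cut_def scale_one_image)
  have cut_out: "cut A S x = {0}" if "x \<notin> A" "S x \<in> Kbcs" for A S x
    using that Kbcs_zero_mem[OF that(2)] by (simp add: cut_def scale_zero_image) blast
  have F_cut: "cut A F \<in> X" if "A \<in> sets M" for A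
    unfolding cut_def X mem_Collect_eq
  proof (rule locally_integrably_bounded_scaleI[OF XD[OF F] _ k(2,3)])
    show "locally_integrable M (\<lambda>x. \<bar>indicat_real A x\<bar> * k x)"
      using that locally_integrable_measurable[OF k(1)] k(2)
      by (intro locally_integrable_bound[OF k(1)] borel_measurable_times borel_measurable_abs) (auto simp: indicator_def)
  qed (use that in auto)
  have ball_cut: "cut (E m) S \<in> X"
    if "set_measurable_fun M S" "\<And>x. x \<in> space M \<Longrightarrow> S x \<subseteq> cball 0 (real (b x) * w x)" for m S
    unfolding cut_def X mem_Collect_eq
  proof (rule locally_integrably_bounded_scaleI[where k = "\<lambda>x. real (b x) * w x"])
    obtain n where n: "\<And>x. x \<in> space M \<Longrightarrow> u x \<le> m \<Longrightarrow> b x \<le> n" using ub[of m] by blast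
    have "locally_integrable M (\<lambda>x. real n * w x)"
      by (intro locally_integrable_cmult integrable_imp_locally_integrable w(3))
    then show "locally_integrable M (\<lambda>x. \<bar>indicat_real (E m) x\<bar> * (real (b x) * w x))"
    proof (rule locally_integrable_bound)
      have "(\<lambda>x. real (b x)) \<in> borel_measurable M" by (rule measurable_compose[OF bm]) simp
      then show "(\<lambda>x. \<bar>indicat_real (E m) x\<bar> * (real (b x) * w x)) \<in> borel_measurable M"
        using w(1) E[of m] by measurable
      show "\<bar>\<bar>indicat_real (E m) x\<bar> * (real (b x) * w x)\<bar> \<le> \<bar>real n * w x\<bar>" if "x \<in> space M" for x
        using n[OF that] w(2)[of x] by (auto simp: indicator_def E_def abs_mult intro!: mult_right_mono)
    qed
    show "0 \<le> real (b x) * w x" if "x \<in> space M" for x using w(2)[of x] by simp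
    show "AE x in M. S x \<subseteq> cball 0 (real (b x) * w x)" by (rule AE_I2[OF that(2)])
  qed (use that(1) E in auto)
  have FX: "cut (E m) F \<in> X" and FcX: "cut (space M - E m) F \<in> X" for m
    using F_cut E by (auto intro: sets.compl_sets)
  have GX: "cut (E m) G \<in> X" and HX: "cut (E m) H \<in> X" for m
    using ball_cut[OF Gm GHb(1)] ball_cut[OF Hm GHb(2)] by auto
  define UF where "UF = (\<lambda>x. (*\<^sub>R) (real (u x)) ` F x)"
  have UFX: "UF \<in> X"
    unfolding UF_def X mem_Collect_eq
  proof (rule locally_integrably_bounded_scaleI[OF XD[OF F] _ k(2,3)])
    show "(\<lambda>x. real (u x)) \<in> borel_measurable M" by (rule measurable_compose[OF um]) simp
    show "locally_integrable M (\<lambda>x. \<bar>real (u x)\<bar> * k x)" using uk by simp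
  qed

  \<comment> \<open>Decomposition of \<open>F\<close> and its image under \<open>T\<close>\<close>
  have dec: "cut (E m) F x \<subseteq> (*\<^sub>R) (s powr \<theta>) ` cut (E m) G x + (*\<^sub>R) (s powr - (1 - \<theta>)) ` cut (E m) H x"
    if x: "x \<in> space M" and s: "0 < s" for m x and s :: real
  proof (cases "x \<in> E m")
    case True
    show ?thesis
      unfolding cut_in[OF True]
    proof
      fix v assume "v \<in> F x"
      then have "?R x v \<le> r x" unfolding r_def by (rule le_set_size[OF NR[OF x] XK[OF F x]])
      then have "?R x v \<le> g0 x powr (1 - \<theta>) * g1 x powr \<theta>"
        unfolding g0_def g1_def interp_p[OF r0[OF x]] .
      then obtain g h where gh: "v = g + h" "\<rho>0 x g \<le> s powr \<theta> * g0 x" "\<rho>1 x h \<le> s powr - (1 - \<theta>) * g1 x"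
        by (rule interp_K_decomposition[where ?\<rho>0.0 = \<rho>0 and ?\<rho>1.0 = \<rho>1 and x = x, OF N0[OF x] N1[OF x] \<theta> g_nonneg _ s])
      have "g \<in> (*\<^sub>R) (s powr \<theta>) ` G x"
      proof
        show "g = s powr \<theta> *\<^sub>R ((1 / s powr \<theta>) *\<^sub>R g)" using s by simp
        show "(1 / s powr \<theta>) *\<^sub>R g \<in> G x"
          using gh(2) s by (simp add: G_def is_normD(3)[OF N0[OF x]] divide_le_eq mult.commute)
      qed
      moreover have "h \<in> (*\<^sub>R) (s powr - (1 - \<theta>)) ` H x"
      proof
        show "h = s powr - (1 - \<theta>) *\<^sub>R ((1 / s powr - (1 - \<theta>)) *\<^sub>R h)" using s by simp
        show "(1 / s powr - (1 - \<theta>)) *\<^sub>R h \<in> H x"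
          using gh(3) s unfolding H_def mem_Collect_eq is_normD(3)[OF N1[OF x]]
          by (simp add: divide_le_eq mult.commute)
      qed
      ultimately show "v \<in> (*\<^sub>R) (s powr \<theta>) ` G x + (*\<^sub>R) (s powr - (1 - \<theta>)) ` H x"
        unfolding gh(1) by (rule set_plus_intro)
    qed
  next
    case False
    have "0 \<in> (*\<^sub>R) (s powr \<theta>) ` cut (E m) G x + (*\<^sub>R) (s powr - (1 - \<theta>)) ` cut (E m) H x"
      using x by (intro Kbcs_zero_mem Kbcs_plus Kbcs_scale XK[OF GX] XK[OF HX])
    then show ?thesis unfolding cut_out[where S = F, OF False XK[OF F x]] by simp
  qed
  have T_dec: "T (cut (E m) F) y \<subseteq> (*\<^sub>R) (s powr \<theta>) ` T (cut (E m) G) y + (*\<^sub>R) (s powr - (1 - \<theta>)) ` T (cut (E m) H) y"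
    if y: "y \<in> space M" and s: "0 < s" for m y and s :: real
  proof -
    have "T (cut (E m) F) y \<subseteq>
        T (\<lambda>x. (*\<^sub>R) (s powr \<theta>) ` cut (E m) G x + (*\<^sub>R) (s powr - (1 - \<theta>)) ` cut (E m) H x) y"
      using dec s y by (intro T_mono FX X_plus X_scale GX HX)
    also have "\<dots> = (*\<^sub>R) (s powr \<theta>) ` T (cut (E m) G) y + (*\<^sub>R) (s powr - (1 - \<theta>)) ` T (cut (E m) H) y"
      using y by (simp only: T_plus[OF X_scale[OF GX] X_scale[OF HX]] T_scale[OF GX] T_scale[OF HX])
    finally show ?thesis .
  qed
  have T_size: "set_size (?R y) (T (cut (E m) F) y) \<le> 2 ^ Suc DIM('a) *
      (set_size (\<rho>0 y) (T (cut (E m) G) y) powr (1 - \<theta>) * set_size (\<rho>1 y) (T (cut (E m) H) y) powr \<theta>)"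
    if y: "y \<in> space M" for m y
    using set_size_interp_norm_le[where ?\<rho>0.0 = \<rho>0 and ?\<rho>1.0 = \<rho>1 and y = y, OF N0[OF y] N1[OF y] \<theta>
        XK[OF TX[OF FX] y] XK[OF TX[OF GX] y] XK[OF TX[OF HX] y] T_dec[OF y]] .

  \<comment> \<open>Endpoint estimates for the truncated balls\<close>
  have end_bound: "(\<integral>\<^sup>+x. ennreal (set_size (\<sigma> x) (T (cut (E m) S) x) powr q') \<partial>M) \<le>
      ennreal (((M' + 1) * J powr (p / p')) powr q')"
    if exps': "0 < p'" "0 < q'" "0 \<le> M'" and \<sigma>: "norm_function M \<sigma>"
      and S: "S = (\<lambda>x. {v. \<sigma> x v \<le> r x powr (p / p')})" "cut (E m) S \<in> X"
      and b': "\<And>F. F \<in> X \<Longrightarrow> LK_norm M q' \<sigma> (T F) \<le> ennreal M' * LK_norm M p' \<sigma> F"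
    for \<sigma> S p' q' M' m
  proof -
    have N: "is_norm (\<sigma> x)" if "x \<in> space M" for x using \<sigma> that by (simp add: norm_function_def)
    have "(\<integral>\<^sup>+x. ennreal (set_size (\<sigma> x) (cut (E m) S x) powr p') \<partial>M) \<le> (\<integral>\<^sup>+x. ennreal (r x powr p) \<partial>M)"
    proof (intro nn_integral_mono ennreal_leI)
      fix x assume x: "x \<in> space M"
      note K = XK[OF S(2) x]
      have SK: "S x \<in> Kbcs" unfolding S(1) by (intro Kbcs_norm_ball N x) simp
      have "set_size (\<sigma> x) (cut (E m) S x) \<le> r x powr (p / p')"
      proof (rule set_size_least[OF K])
        fix v assume "v \<in> cut (E m) S x"
        moreover have "cut (E m) S x \<subseteq> S x"
          using cut_in[of x "E m" S] cut_out[of x "E m" S, OF _ SK] Kbcs_zero_mem[OF SK] by (cases "x \<in> E m") auto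
        ultimately show "\<sigma> x v \<le> r x powr (p / p')" unfolding S(1) by blast
      qed
      then have "set_size (\<sigma> x) (cut (E m) S x) powr p' \<le> (r x powr (p / p')) powr p'"
        using exps' set_size_nonneg[OF N[OF x] K] by (intro powr_mono2) auto
      then show "set_size (\<sigma> x) (cut (E m) S x) powr p' \<le> r x powr p" using exps' by (simp add: powr_powr)
    qed
    also have "\<dots> \<le> ennreal (J powr p)" by (rule r_int)
    also have "J powr p = (J powr (p / p')) powr p'" using exps' by (simp add: powr_powr)
    finally have "LK_norm M p' \<sigma> (cut (E m) S) \<le> ennreal (J powr (p / p'))"
      by (subst LK_norm_le_iff) (use exps' in auto)
    then have "ennreal M' * LK_norm M p' \<sigma> (cut (E m) S) \<le> ennreal M' * ennreal (J powr (p / p'))"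
      by (rule mult_left_mono) simp
    also have "\<dots> = ennreal (M' * J powr (p / p'))" using exps' by (simp add: ennreal_mult)
    also have "\<dots> \<le> ennreal ((M' + 1) * J powr (p / p'))" by (intro ennreal_leI mult_right_mono) auto
    finally have "LK_norm M q' \<sigma> (T (cut (E m) S)) \<le> ennreal ((M' + 1) * J powr (p / p'))"
      using b'[OF S(2)] by (rule order_trans[rotated])
    then show ?thesis by (subst (asm) LK_norm_le_iff) (use exps' in auto)
  qed

  \<comment> \<open>The estimate for truncated \<open>F\<close>\<close>
  define C where "C = 2 ^ Suc DIM('a) * ((M0 + 1) powr (1 - \<theta>) * (M1 + 1) powr \<theta>) * J"
  have trunc: "(\<integral>\<^sup>+x. ennreal (set_size (?R x) (T (cut (E m) F) x) powr q) \<partial>M) \<le> ennreal (C powr q)" for m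
  proof -
    have "(\<integral>\<^sup>+x. ennreal (set_size (?R x) (T (cut (E m) F) x) powr q) \<partial>M) \<le>
        ennreal ((2 ^ Suc DIM('a) * (((M0 + 1) * J powr (p / p0)) powr (1 - \<theta>) *
          ((M1 + 1) * J powr (p / p1)) powr \<theta>)) powr q)"
    proof (rule interp_nn_integral_le[OF \<theta> exps(6,3,4) q])
      show "(\<lambda>x. set_size (\<rho>0 x) (T (cut (E m) G) x)) \<in> borel_measurable M"
        by (rule set_size_measurable[OF \<rho>(1) XD[OF TX[OF GX]]])
      show "(\<lambda>x. set_size (\<rho>1 x) (T (cut (E m) H) x)) \<in> borel_measurable M"
        by (rule set_size_measurable[OF \<rho>(2) XD[OF TX[OF HX]]])
      show "(\<integral>\<^sup>+x. ennreal (set_size (\<rho>0 x) (T (cut (E m) G) x) powr q0) \<partial>M) \<le>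
          ennreal (((M0 + 1) * J powr (p / p0)) powr q0)"
        by (rule end_bound[OF exps(1,3) M01(1) \<rho>(1) _ GX b0]) (simp_all add: G_def g0_def)
      show "(\<integral>\<^sup>+x. ennreal (set_size (\<rho>1 x) (T (cut (E m) H) x) powr q1) \<partial>M) \<le>
          ennreal (((M1 + 1) * J powr (p / p1)) powr q1)"
        by (rule end_bound[OF exps(2,4) M01(2) \<rho>(2) _ HX b1]) (simp_all add: H_def g1_def)
    next
      fix x assume x: "x \<in> space M"
      show "0 \<le> set_size (\<rho>0 x) (T (cut (E m) G) x)" by (rule set_size_nonneg[OF N0[OF x] XK[OF TX[OF GX] x]])
      show "0 \<le> set_size (\<rho>1 x) (T (cut (E m) H) x)" by (rule set_size_nonneg[OF N1[OF x] XK[OF TX[OF HX] x]])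
      show "0 \<le> set_size (?R x) (T (cut (E m) F) x)" by (rule set_size_nonneg[OF NR[OF x] XK[OF TX[OF FX] x]])
    qed (use T_size M01 J in auto)
    \<comment> \<open>The two endpoint powers of \<open>J\<close> recombine to \<open>J\<close> by
      the same identity that recombines \<open>g0\<close> and \<open>g1\<close> to
      \<open>r\<close>.\<close>
    also have "2 ^ Suc DIM('a) * (((M0 + 1) * J powr (p / p0)) powr (1 - \<theta>) *
          ((M1 + 1) * J powr (p / p1)) powr \<theta>) =
        2 ^ Suc DIM('a) * ((M0 + 1) powr (1 - \<theta>) * (M1 + 1) powr \<theta>) *
          ((J powr (p / p0)) powr (1 - \<theta>) * (J powr (p / p1)) powr \<theta>)"
      using M01 by (simp add: powr_mult)
    also have "\<dots> = C" using J(1) by (simp only: interp_p[OF less_imp_le[OF J(1)]] C_def)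
    finally show ?thesis .
  qed

  \<comment> \<open>Pointwise convergence of the truncations under \<open>T\<close>\<close>
  have lim: "(\<lambda>m. set_size (?R y) (T (cut (E m) F) y)) \<longlonglongrightarrow> set_size (?R y) (T F y)" if y: "y \<in> space M" for y
  proof -
    let ?s = "\<lambda>m. set_size (?R y) (T (cut (E m) F) y)" and ?S = "set_size (?R y) (T F y)"
      and ?Q = "set_size (?R y) (T UF y)"
    have split: "F x \<subseteq> cut (E m) F x + cut (space M - E m) F x" and below: "cut (E m) F x \<subseteq> F x"
      and tail: "(*\<^sub>R) (real m) ` cut (space M - E m) F x \<subseteq> UF x" if x: "x \<in> space M" for m x
    proof -
      note K = XK[OF F x]
      have "F x \<subseteq> cut (E m) F x + cut (space M - E m) F x \<and> cut (E m) F x \<subseteq> F x \<and>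
          (*\<^sub>R) (real m) ` cut (space M - E m) F x \<subseteq> UF x"
      proof (cases "x \<in> E m")
        case True
        then have "cut (space M - E m) F x = {0}" by (intro cut_out K) simp
        moreover have "0 \<in> UF x" by (rule Kbcs_zero_mem[OF XK[OF UFX x]])
        ultimately show ?thesis by (simp add: cut_in[OF True] set_plus_def)
      next
        case False
        then have "real m \<le> real (u x)" using x by (simp add: E_def)
        then have "(*\<^sub>R) (real m) ` F x \<subseteq> UF x" unfolding UF_def by (intro Kbcs_scale_mono[OF K]) auto
        moreover have "cut (space M - E m) F x = F x" using False x by (intro cut_in) simp
        ultimately show ?thesis using Kbcs_zero_mem[OF K] by (simp add: cut_out[where S = F, OF False K] set_plus_def)
      qed
      then show "F x \<subseteq> cut (E m) F x + cut (space M - E m) F x" "cut (E m) F x \<subseteq> F x"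
        "(*\<^sub>R) (real m) ` cut (space M - E m) F x \<subseteq> UF x" by blast+
    qed
    have upper: "?s m \<le> ?S" for m
      using below y by (intro set_size_mono NR XK[OF TX] T_mono FX F)
    \<comment> \<open>Subadditivity leaves the size of \<open>T\<close> at the remainder. Since
      \<open>m\<close> times the remainder is contained in \<open>UF\<close>, homogeneity and
      monotonicity bound that size by \<open>?Q / real m\<close>.\<close>
    have lower: "?S - ?Q / real m \<le> ?s m" if m: "0 < m" for m
    proof -
      let ?c = "set_size (?R y) (T (cut (space M - E m) F) y)"
      have "T F y \<subseteq> T (\<lambda>x. cut (E m) F x + cut (space M - E m) F x) y"
        using split y by (intro T_mono F X_plus FX FcX)
      also have "\<dots> = T (cut (E m) F) y + T (cut (space M - E m) F) y" by (rule T_plus[OF FX FcX y])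
      finally have "?S \<le> set_size (?R y) (T (cut (E m) F) y + T (cut (space M - E m) F) y)"
        using y by (intro set_size_mono NR Kbcs_plus XK[OF TX] FX FcX F)
      also have "\<dots> \<le> ?s m + ?c" using y by (intro set_size_plus_le NR XK[OF TX] FX FcX)
      finally have "?S \<le> ?s m + ?c" .
      moreover have "real m * ?c \<le> ?Q"
      proof -
        have "real m * ?c \<le> set_size (?R y) ((*\<^sub>R) (real m) ` T (cut (space M - E m) F) y)"
          using y by (intro scale_set_size_le NR XK[OF TX] FcX) auto
        also have "(*\<^sub>R) (real m) ` T (cut (space M - E m) F) y =
            T (\<lambda>x. (*\<^sub>R) (real m) ` cut (space M - E m) F x) y" by (rule T_scale[OF FcX y, symmetric])
        also have "set_size (?R y) \<dots> \<le> ?Q"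
          using tail y by (intro set_size_mono NR XK[OF TX] T_mono X_scale FcX UFX)
        finally show ?thesis .
      qed
      then have "?c \<le> ?Q / real m" using m by (simp add: field_simps)
      ultimately show ?thesis by linarith
    qed
    have "(\<lambda>m. ?S - ?Q / real m) \<longlonglongrightarrow> ?S - 0" by (intro tendsto_intros lim_const_over_n)
    then have "(\<lambda>m. ?S - ?Q / real m) \<longlonglongrightarrow> ?S" by simp
    then show ?thesis
    proof (rule tendsto_sandwich[rotated 2])
      show "\<forall>\<^sub>F m in sequentially. ?S - ?Q / real m \<le> ?s m"
        using eventually_gt_at_top[of 0] by eventually_elim (rule lower)
      show "\<forall>\<^sub>F m in sequentially. ?s m \<le> ?S" by (intro always_eventually allI upper)
    qed simp
  qed

  \<comment> \<open>Passage to the limit by Fatou's lemma\<close>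
  have "(\<integral>\<^sup>+x. ennreal (set_size (?R x) (T F x) powr q) \<partial>M) =
      (\<integral>\<^sup>+x. liminf (\<lambda>m. ennreal (set_size (?R x) (T (cut (E m) F) x) powr q)) \<partial>M)"
  proof (rule nn_integral_cong)
    fix x assume x: "x \<in> space M"
    have "(\<lambda>m. set_size (?R x) (T (cut (E m) F) x) powr q) \<longlonglongrightarrow> set_size (?R x) (T F x) powr q"
      using lim[OF x] exps(6) set_size_nonneg[OF NR[OF x] XK[OF TX[OF FX] x]]
      by (intro tendsto_powr') (auto intro!: always_eventually)
    then have "(\<lambda>m. ennreal (set_size (?R x) (T (cut (E m) F) x) powr q)) \<longlonglongrightarrow> ennreal (set_size (?R x) (T F x) powr q)"
      by (rule tendsto_ennrealI)
    then show "ennreal (set_size (?R x) (T F x) powr q) =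
        liminf (\<lambda>m. ennreal (set_size (?R x) (T (cut (E m) F) x) powr q))"
      by (intro lim_imp_Liminf[symmetric]) auto
  qed
  also have "\<dots> \<le> liminf (\<lambda>m. \<integral>\<^sup>+x. ennreal (set_size (?R x) (T (cut (E m) F) x) powr q) \<partial>M)"
    using set_size_measurable[OF \<rho>R XD[OF TX[OF FX]]]
    by (intro nn_integral_liminf) measurable
  also have "\<dots> \<le> liminf (\<lambda>m::nat. ennreal (C powr q))"
    by (intro Liminf_mono always_eventually allI trunc)
  also have "\<dots> = ennreal (C powr q)" by (simp add: Liminf_const)
  finally have "LK_norm M q ?R (T F) \<le> ennreal C"
    using J(1) exps(6) by (subst LK_norm_le_iff) (simp_all add: C_def)
  then show ?thesis unfolding C_def .
qed

theorem theorem4p1: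
  fixes M :: "(real ^ 'n) measure"
    and \<rho>0 \<rho>1 :: "real ^ 'n \<Rightarrow> real ^ 'd \<Rightarrow> real"
    and p0 p1 q0 q1 M0 M1 :: real
    and X :: "(real ^ 'n \<Rightarrow> (real ^ 'd) set) set"
    and T :: "(real ^ 'n \<Rightarrow> (real ^ 'd) set) \<Rightarrow> (real ^ 'n \<Rightarrow> (real ^ 'd) set)"
  assumes "sigma_finite_measure M" and "complete_measure M"
    and "1 \<le> p0" and "1 \<le> p1" and "1 \<le> q0" and "1 \<le> q1"
    and "norm_function M \<rho>0" and "norm_function M \<rho>1"
    and X_def: "X = {F. locally_integrably_bounded M F}"
    and "\<And>F. F \<in> X \<Longrightarrow> T F \<in> X"
    and "linear_operator_on M X T" and "monotone_operator_on M X T"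
    and "0 \<le> M0" and "0 \<le> M1"
    and "\<And>F. F \<in> X \<Longrightarrow> LK_norm M q0 \<rho>0 (T F) \<le> ennreal M0 * LK_norm M p0 \<rho>0 F"
    and "\<And>F. F \<in> X \<Longrightarrow> LK_norm M q1 \<rho>1 (T F) \<le> ennreal M1 * LK_norm M p1 \<rho>1 F"
    and "\<And>A S. A \<in> sets M \<Longrightarrow> S \<in> Kbcs \<Longrightarrow> chi A S \<in> X \<Longrightarrow>
           bounded ((\<lambda>x. set_size (\<rho>0 x) (chi A S x)) ` space M) \<Longrightarrow>
           bounded ((\<lambda>x. set_size (\<rho>1 x) (chi A S x)) ` space M) \<Longrightarrow>
           bounded ((\<lambda>x. set_size (\<rho>0 x) (T (chi A S) x)) ` space M) \<and>
           bounded ((\<lambda>x. set_size (\<rho>1 x) (T (chi A S) x)) ` space M)"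
  shows "\<forall>\<theta> p q. 0 < \<theta> \<and> \<theta> < 1 \<and>
           1 / p = (1 - \<theta>) / p0 + \<theta> / p1 \<and> 1 / q = (1 - \<theta>) / q0 + \<theta> / q1 \<longrightarrow>
         (\<exists>M\<theta>::real. 0 \<le> M\<theta> \<and>
            (\<forall>F. simple_set_fun M F \<and> F \<in> X \<and> F \<in> LK M p (interp_norm \<theta> \<rho>0 \<rho>1) \<longrightarrow>
               LK_norm M q (interp_norm \<theta> \<rho>0 \<rho>1) (T F)
                 \<le> ennreal M\<theta> * LK_norm M p (interp_norm \<theta> \<rho>0 \<rho>1) F)) \<and>
         (\<exists>C::real. 0 \<le> C \<and>
            (\<forall>F. F \<in> X \<and> F \<in> LK M p (interp_norm \<theta> \<rho>0 \<rho>1) \<longrightarrow>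
               LK_norm M q (interp_norm \<theta> \<rho>0 \<rho>1) (T F)
                 \<le> ennreal C * LK_norm M p (interp_norm \<theta> \<rho>0 \<rho>1) F))"
proof (intro allI impI)
  fix \<theta> p q :: real
  assume *: "0 < \<theta> \<and> \<theta> < 1 \<and>
    1 / p = (1 - \<theta>) / p0 + \<theta> / p1 \<and> 1 / q = (1 - \<theta>) / q0 + \<theta> / q1"
  let ?R = "interp_norm \<theta> \<rho>0 \<rho>1"
  have "0 < 1 / p" "0 < 1 / q"
    using * assms(3-6) by (auto intro!: add_pos_pos divide_pos_pos)
  \<comment> \<open>As 1/0 = 0 in HOL, positivity of the reciprocals also excludes
    \<open>p = 0\<close> and \<open>q = 0\<close>.\<close>
  then have pq: "0 < p" "0 < q" by (simp_all add: zero_less_divide_iff)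
  define C where "C = 2 ^ Suc DIM(real ^ 'd) * ((M0 + 1) powr (1 - \<theta>) * (M1 + 1) powr \<theta>)"
  have C: "0 < C" using assms(13,14) by (simp add: C_def)
  have bound: "LK_norm M q ?R (T F) \<le> ennreal C * LK_norm M p ?R F" if F: "F \<in> X" "F \<in> LK M p ?R" for F
  proof -
    have "LK_norm M p ?R F < \<infinity>" using F(2) by (simp add: LK_def)
    then obtain l where l: "0 \<le> l" "LK_norm M p ?R F = ennreal l" by (cases "LK_norm M p ?R F") auto
    \<comment> \<open>The norm \<open>l\<close> may vanish, so the estimate is applied with
      \<open>J = l + e / C\<close>; its excess over the desired bound is exactly \<open>e\<close>,
      which is arbitrary.\<close>
    have le: "LK_norm M q ?R (T F) \<le> ennreal (C * l) + ennreal e" if e: "0 < e" for e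
    proof -
      have J: "0 < l + e / C" using l(1) e C by (simp add: add_nonneg_pos)
      have "LK_norm M q ?R (T F) \<le> ennreal (2 ^ Suc DIM(real ^ 'd) *
          ((M0 + 1) powr (1 - \<theta>) * (M1 + 1) powr \<theta>) * (l + e / C))"
      proof (rule interp_operator_bound[where ?p0.0 = p0 and ?p1.0 = p1 and ?q0.0 = q0 and ?q1.0 = q1 and p = p
            and X = X and T = T and F = F and ?\<rho>0.0 = \<rho>0 and ?\<rho>1.0 = \<rho>1 and ?M0.0 = M0 and ?M1.0 = M1])
        show "LK_norm M p ?R F \<le> ennreal (l + e / C)"
          unfolding l(2) using e C by (intro ennreal_leI) simp
      qed (use assms * pq J F in auto)
      also have "\<dots> = ennreal (C * (l + e / C))" unfolding C_def[symmetric] ..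
      also have "C * (l + e / C) = C * l + e" using C by (simp add: distrib_left)
      also have "ennreal (C * l + e) = ennreal (C * l) + ennreal e"
        using C l e by (intro ennreal_plus) auto
      finally show ?thesis .
    qed
    have "LK_norm M q ?R (T F) \<le> ennreal (C * l)" by (rule ennreal_le_epsilon) (rule le)
    then show ?thesis using l C by (simp add: ennreal_mult)
  qed
  then show "(\<exists>M\<theta>::real. 0 \<le> M\<theta> \<and>
            (\<forall>F. simple_set_fun M F \<and> F \<in> X \<and> F \<in> LK M p ?R \<longrightarrow>
               LK_norm M q ?R (T F) \<le> ennreal M\<theta> * LK_norm M p ?R F)) \<and>
         (\<exists>C::real. 0 \<le> C \<and>
            (\<forall>F. F \<in> X \<and> F \<in> LK M p ?R \<longrightarrow>
               LK_norm M q ?R (T F) \<le> ennreal C * LK_norm M p ?R F))"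
    using C by (intro conjI exI[of _ C]) auto
qed

end
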